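(* Let $\mathcal{L}$ be a finite lattice with minimal element $\hat{0}$ and maximal element $\hat{1}$, $\overline{\mathcal{L}}=\mathcal{L}\setminus\{\hat{0}\}$ and $\check{\mathcal{L}}=\mathcal{L}\setminus\{\hat{0},\hat{1}\}$. Let $\gamma=\hat{1}*\zeta\in\mathcal{S}_m(\overline{\mathcal{L}})^{(\hat{1})}$ be a principal $m$-synor chain and for some $1\le\ell\le m$ let $\gamma=\sum_{\chi\in X_\ell^\gamma}\chi*\zeta_\chi$ be its $\ell$-representation. Then $\gamma$ is homologous to $$\sum_{\chi\in X_\ell^\gamma}\rho_\ell(\chi)\,⧢\,\zeta_\chi$$ in $\widetilde{H}_m(\overline{\mathcal{L}},\check{\mathcal{L}})$. (Here $⧢$ denotes the shuffle product.)
   Context: Chains. Fix a field $\mathbb{K}$. For a finite poset $\mathcal{P}$ and $k \ge -1$, $\widetilde{M}_k(\mathcal{P})$ is the $\mathbb{K}$-vector space with basis the order multichains $(c_0\ge\cdots\ge c_k)$ in $\mathcal{P}$, and $\widetilde{C}_k(\mathcal{P})$ is the subspace spanned by the order chains $(x_0 > \cdots > x_k)$ (for $k=-1$ both have basis the empty chain $\emptyset$). Both carry the differential $\partial_k = \sum_{j=0}^k (-1)^j\partial_k^{(j)}$, where $\partial_k^{(j)}$ deletes the entry with index $j$; $\partial_{-1}=0$. $\pi:\widetilde{M}_*(\mathcal{P})\to\widetilde{C}_*(\mathcal{P})$ is the identity on order chains and $0$ on multichains with repetitions. $\widetilde{H}_*(\mathcal{P})$ is the homology of $\widetilde{C}_*(\mathcal{P})$;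 for $\mathcal{Q}\subseteq\mathcal{P}$, $\widetilde{H}_*(\mathcal{P},\mathcal{Q})$ is the homology of $\widetilde{C}_*(\mathcal{P})/\widetilde{C}_*(\mathcal{Q})$. $\mathcal{P}_{<x}$, $\mathcal{P}_{\le x}$ are the sets of elements $<x$, $\le x$. For an order chain $\chi$ with minimal element $\min(\chi)$ and a chain $\sum\lambda_r c_r$ supported in $\mathcal{P}_{<\min(\chi)}$, $\chi*\sum\lambda_rc_r=\sum\lambda_r\,\chi*c_r$, where $\chi*c_r$ is concatenation. Synor complex. $\widetilde{C}_i(\mathcal{P})^{(x)}$ is the span of the order chains of length $i$ with largest element $x$. A synor complex of $\mathcal{P}$, viewed as a subcomplex $\mathcal{S}_*(\mathcal{P})\subseteq\widetilde{C}_*(\mathcal{P})$, satisfies: $\mathcal{S}_{-1}(\mathcal{P})=\mathbb{K}\emptyset$; $\mathcal{S}_i(\mathcal{P})=\bigoplus_{x}\mathcal{S}_i(\mathcal{P})^{(x)}$ with $\mathcal{S}_i(\mathcal{P})^{(x)}\subseteq\widetilde{C}_i(\mathcal{P})^{(x)}$ for $i\ge0$; $\partial_i(\mathcal{S}_i(\mathcal{P})^{(x)})\subseteq\bigoplus_{y<x}\mathcal{S}_{i-1}(\mathcal{P})^{(y)}$ for $i\ge1$; (S1) $\dim\mathcal{S}_i(\mathcal{P})^{(x)}=\dim\widetilde{H}_{i-1}(\mathcal{P}_{<x})$; (S2) for every order ideal $\mathcal{J}$ of $\mathcal{P}$ the inclusion of the subcomplex $\mathcal{S}_*(\mathcal{P})^{\mathcal{J}}$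 (equal to $\bigoplus_{x\in\mathcal{J}}\mathcal{S}_i(\mathcal{P})^{(x)}$ in degrees $i\ge0$ and $\mathbb{K}\emptyset$ in degree $-1$) into $\widetilde{C}_*(\mathcal{J})$ induces an isomorphism on homology. Fix a synor complex of $\overline{\mathcal{L}}$. Representations. A principal $m$-synor chain is an element $\gamma\in\mathcal{S}_m(\mathcal{P})^{(x)}$ for some $x \in \mathcal{P}$. $X_\ell^\gamma$ ($0\le\ell\le m$) is the set of order chains $(x_0>\cdots>x_\ell)$ that are initial segments of order chains $(x_0>\cdots>x_\ell>\cdots>x_m)$ in the support of $\gamma$. The $\ell$-representation of $\gamma$ is the (unique) expression $\gamma=\sum_{\chi\in X_\ell^\gamma}\chi*\zeta_\chi$ with $\zeta_\chi\in\widetilde{C}_{m-\ell-1}(\mathcal{P}_{<\min(\chi)})$; each $\zeta_\chi$ is then a cycle in $\bigoplus_{y<\min(\chi)}\mathcal{S}_{m-\ell-1}(\mathcal{P})^{(y)}$ (a scalar multiple of $\emptyset$ if $\ell=m$). In particular $\gamma=x*\zeta$ is its $0$-representation. The maps $\rho$. Fix linear maps $\rho_k:\widetilde{C}_k(\overline{\mathcal{L}})\to\mathcal{S}_k(\overline{\mathcal{L}})$, $k\ge-2$ (zero for $k=-2$), such that $\rho_{-1}(\emptyset)=\emptyset$; $\rho_{k-1}\circ\partial_k=\partial_k\circ\rho_k$ for $k\ge-1$; and for $k\ge0$ and every order chain $c=(x_0>\cdots>x_k)$, $\rho_k(c)$ is supported in $\overline{\mathcal{L}}_{\le x_0}$.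 (Such maps exist.) Shuffle product. For $a=(a_0,\ldots,a_k)\in\mathcal{L}^{k+1}$ let $\tau(a)=(a_0\vee\cdots\vee a_k\ge a_1\vee\cdots\vee a_k\ge\cdots\ge a_k)$, and for a permutation $\sigma$ of $\{0,\ldots,k\}$ let $a_\sigma=(a_{\sigma(0)},\ldots,a_{\sigma(k)})$. $S_{i,j}$ is the set of permutations $\sigma$ of $\{0,\ldots,i+j+1\}$ such that $\sigma^{-1}$ is increasing on $\{0,\ldots,i\}$ and on $\{i+1,\ldots,i+j+1\}$. For an $i$-multichain $\mathfrak{c}$ and a $j$-multichain $\mathfrak{c}'$ ($i,j\ge-1$), with concatenated tuple $\mathfrak{c}\cdot\mathfrak{c}'$, set $\mathfrak{c}\,⧢\,\mathfrak{c}'=\sum_{\sigma\in S_{i,j}}\mathrm{sgn}(\sigma)\,\tau((\mathfrak{c}\cdot\mathfrak{c}')_\sigma)\in\widetilde{M}_{i+j+1}(\mathcal{L})$, extended bilinearly. Convention: in the claim $\pi$ is implicitly applied to every shuffle product, so that it lies in $\widetilde{C}_*$. *)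

theory Defs
  imports
    Complex_Main
    "HOL-Library.Poly_Mapping"
    "HOL-Combinatorics.Permutations"
begin

text \<open>
  A tuple \<open>(x\<^sub>0, \<dots>, x\<^sub>k)\<close> is the list \<open>[x\<^sub>0, \<dots>, x\<^sub>k]\<close>, so the empty chain of degree \<open>-1\<close>
  is \<open>[]\<close>. Formal linear combinations over the field \<open>'k\<close> are finitely supported functions.
  Degrees are integers.
\<close>

section \<open>Formal linear combinations\<close>

type_synonym ('a, 'k) chain = "'a list \<Rightarrow>\<^sub>0 'k"

definition cscale :: "'k::field \<Rightarrow> ('b \<Rightarrow>\<^sub>0 'k) \<Rightarrow> ('b \<Rightarrow>\<^sub>0 'k)" where
  "cscale c p = Poly_Mapping.map ((*) c) p"

lemma lookup_cscale [simp]: "Poly_Mapping.lookup (cscale c p) x = c * Poly_Mapping.lookup p x"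
  unfolding cscale_def by (transfer, simp add: when_def)

global_interpretation chain: vector_space "cscale :: 'k::field \<Rightarrow> ('b \<Rightarrow>\<^sub>0 'k) \<Rightarrow> _"
  by unfold_locales (auto intro!: poly_mapping_eqI simp: Poly_Mapping.lookup_add algebra_simps)

definition lin_ext :: "('b \<Rightarrow> ('c \<Rightarrow>\<^sub>0 'k)) \<Rightarrow> ('b \<Rightarrow>\<^sub>0 'k::field) \<Rightarrow> ('c \<Rightarrow>\<^sub>0 'k)" where
  "lin_ext f p = (\<Sum>x\<in>Poly_Mapping.keys p. cscale (Poly_Mapping.lookup p x) (f x))"

definition quotient_basis ::
  "('b \<Rightarrow>\<^sub>0 'k::field) set \<Rightarrow> ('b \<Rightarrow>\<^sub>0 'k) set \<Rightarrow> ('b \<Rightarrow>\<^sub>0 'k) set \<Rightarrow> bool" where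
  \<comment> \<open>\<open>E\<close> represents a finite basis of \<open>Z / B\<close>: every class is a unique combination of the
    classes of the elements of \<open>E\<close>.\<close>
  "quotient_basis Z B E \<longleftrightarrow> finite E \<and> E \<subseteq> Z \<and>
     (\<forall>z\<in>Z. \<exists>!c. (\<forall>e. e \<notin> E \<longrightarrow> c e = 0) \<and> z - (\<Sum>e\<in>E. cscale (c e) e) \<in> B)"

definition quotient_dim :: "('b \<Rightarrow>\<^sub>0 'k::field) set \<Rightarrow> ('b \<Rightarrow>\<^sub>0 'k) set \<Rightarrow> nat" where
  "quotient_dim Z B = card (SOME E. quotient_basis Z B E)"

text \<open>For finite-dimensional \<open>Z\<close> the dimension of \<open>Z / B\<close> is well defined.\<close>

lemma quotient_basis_card:
  fixes Z B :: "('b \<Rightarrow>\<^sub>0 'k::field) set"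
  assumes Z: "chain.subspace Z" and B: "chain.subspace B" and BZ: "B \<subseteq> Z"
    and K: "finite K" "Z \<subseteq> chain.span K" and E: "quotient_basis Z B E"
  shows "chain.dim Z = card E + chain.dim B"
proof -
  obtain F where F: "F \<subseteq> B" "chain.independent F" "B \<subseteq> chain.span F" "card F = chain.dim B"
    by (rule chain.basis_exists)
  have finF: "finite F"
    using chain.independent_span_bound[OF K(1) F(2)] F(1) BZ K(2) by blast
  have finE: "finite E" and EZ: "E \<subseteq> Z" using E by (auto simp: quotient_basis_def)
  have uniq: "c = (\<lambda>_. 0)"
    if c: "\<forall>e. e \<notin> E \<longrightarrow> c e = 0" "(\<Sum>e\<in>E. cscale (c e) e) \<in> B" for c
  proof -
    define Q where "Q c \<longleftrightarrow> (\<forall>e. e \<notin> E \<longrightarrow> c e = 0) \<and> 0 - (\<Sum>e\<in>E. cscale (c e) e) \<in> B" for c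
    have "0 \<in> Z" using chain.subspace_0[OF Z] .
    then have ex: "\<exists>!c. Q c"
      using E unfolding quotient_basis_def Q_def by blast
    have "Q c"
      using chain.subspace_neg[OF B c(2)] c(1) by (simp add: Q_def)
    moreover have "Q (\<lambda>_. 0)"
      using chain.subspace_0[OF B] by (simp add: Q_def)
    ultimately show ?thesis using ex by auto
  qed
  have disj: "E \<inter> F = {}"
  proof (rule ccontr)
    assume "E \<inter> F \<noteq> {}"
    then obtain e where e: "e \<in> E" "e \<in> B" using F(1) by blast
    have "(\<Sum>x\<in>E. cscale (if x = e then 1 else 0) x) = (\<Sum>x\<in>E. if x = e then e else 0)"
      by (rule sum.cong) auto
    also have "\<dots> = e" using finE e(1) by simp
    finally have "(\<lambda>x. if x = e then 1 else 0) = (\<lambda>_. 0::'k)"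
      using e by (intro uniq) auto
    then show False by (metis zero_neq_one)
  qed
  have ind: "chain.independent (E \<union> F)"
  proof (rule chain.independent_if_scalars_zero)
    show "finite (E \<union> F)" using finE finF by simp
  next
    fix u x assume u: "(\<Sum>x\<in>E \<union> F. cscale (u x) x) = 0" and x: "x \<in> E \<union> F"
    have split: "(\<Sum>x\<in>E. cscale (u x) x) + (\<Sum>x\<in>F. cscale (u x) x) = 0"
      using u sum.union_disjoint[OF finE finF disj, of "\<lambda>x. cscale (u x) x"] by simp
    have inB: "(\<Sum>x\<in>F. cscale (u x) x) \<in> B"
      using F(1) by (intro chain.subspace_sum[OF B] chain.subspace_scale[OF B]) auto
    have "(\<Sum>x\<in>E. cscale (u x) x) = - (\<Sum>x\<in>F. cscale (u x) x)"
      using split by (simp add: add_eq_0_iff2)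
    then have inB': "(\<Sum>x\<in>E. cscale (u x) x) \<in> B"
      using chain.subspace_neg[OF B inB] by simp
    have "(\<Sum>x\<in>E. cscale (if x \<in> E then u x else 0) x) = (\<Sum>x\<in>E. cscale (u x) x)"
      by (rule sum.cong) auto
    then have "(\<lambda>x. if x \<in> E then u x else 0) = (\<lambda>_. 0)"
      using inB' by (intro uniq) auto
    then have uE: "u y = 0" if "y \<in> E" for y using that by metis
    then have "(\<Sum>x\<in>F. cscale (u x) x) = 0" using split by simp
    then have "u y = 0" if "y \<in> F" for y
      using chain.independentD[OF F(2) finF subset_refl] that by blast
    then show "u x = 0" using uE x by blast
  qed
  have span: "Z \<subseteq> chain.span (E \<union> F)"
  proof
    fix z assume "z \<in> Z"
    then obtain c where "z - (\<Sum>e\<in>E. cscale (c e) e) \<in> B"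
      using E unfolding quotient_basis_def by blast
    then have "z - (\<Sum>e\<in>E. cscale (c e) e) \<in> chain.span (E \<union> F)"
      using F(3) chain.span_mono[of F "E \<union> F"] by blast
    moreover have "(\<Sum>e\<in>E. cscale (c e) e) \<in> chain.span (E \<union> F)"
      by (intro chain.span_sum chain.span_scale chain.span_base) auto
    ultimately show "z \<in> chain.span (E \<union> F)" using chain.span_add by fastforce
  qed
  have "chain.dim Z = card (E \<union> F)"
    using chain.basis_card_eq_dim[OF _ span ind] EZ F(1) BZ by auto
  then show ?thesis using card_Un_disjoint[OF finE finF disj] F(4) by simp
qed

lemma quotient_basis_exists:
  fixes Z B :: "('b \<Rightarrow>\<^sub>0 'k::field) set"
  assumes Z: "chain.subspace Z" and B: "chain.subspace B" and BZ: "B \<subseteq> Z"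
    and K: "finite K" "Z \<subseteq> chain.span K"
  shows "\<exists>E. quotient_basis Z B E"
proof -
  obtain F where F: "F \<subseteq> B" "chain.independent F" "B \<subseteq> chain.span F"
    by (rule chain.basis_exists)
  obtain G where G: "F \<subseteq> G" "G \<subseteq> Z" "chain.independent G" "Z \<subseteq> chain.span G"
    using chain.maximal_independent_subset_extend[OF _ F(2), of Z] F(1) BZ by blast
  have finG: "finite G"
    using chain.independent_span_bound[OF K(1) G(3)] G(2) K(2) by blast
  then have finF: "finite F" using G(1) finite_subset by blast
  have "\<exists>!c. (\<forall>e. e \<notin> G - F \<longrightarrow> c e = 0) \<and> z - (\<Sum>e\<in>G - F. cscale (c e) e) \<in> B"
    if z: "z \<in> Z" for z
  proof -
    obtain u where u: "z = (\<Sum>g\<in>G. cscale (u g) g)"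
      using z G(4) chain.span_finite[OF finG] by auto
    define c where "c e = (if e \<in> G - F then u e else 0)" for e
    have "z = (\<Sum>g\<in>G - F. cscale (u g) g) + (\<Sum>g\<in>F. cscale (u g) g)"
      unfolding u using sum.subset_diff[OF G(1) finG] by blast
    moreover have "(\<Sum>g\<in>G - F. cscale (u g) g) = (\<Sum>g\<in>G - F. cscale (c g) g)"
      by (rule sum.cong) (auto simp: c_def)
    ultimately have "z - (\<Sum>g\<in>G - F. cscale (c g) g) = (\<Sum>g\<in>F. cscale (u g) g)" by simp
    moreover have "(\<Sum>g\<in>F. cscale (u g) g) \<in> B"
      using F(1) by (intro chain.subspace_sum[OF B] chain.subspace_scale[OF B]) auto
    ultimately have c: "z - (\<Sum>g\<in>G - F. cscale (c g) g) \<in> B" by simp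
    show ?thesis
    proof (rule ex1I[of _ c])
      show "(\<forall>e. e \<notin> G - F \<longrightarrow> c e = 0) \<and> z - (\<Sum>e\<in>G - F. cscale (c e) e) \<in> B"
        using c by (simp add: c_def)
    next
      fix d assume d: "(\<forall>e. e \<notin> G - F \<longrightarrow> d e = 0) \<and> z - (\<Sum>e\<in>G - F. cscale (d e) e) \<in> B"
      have "(z - (\<Sum>e\<in>G - F. cscale (d e) e)) - (z - (\<Sum>e\<in>G - F. cscale (c e) e)) \<in> B"
        using d c chain.subspace_diff[OF B] by blast
      moreover have "(z - (\<Sum>e\<in>G - F. cscale (d e) e)) - (z - (\<Sum>e\<in>G - F. cscale (c e) e))
          = (\<Sum>e\<in>G - F. cscale (c e - d e) e)"
        by (simp add: chain.scale_left_diff_distrib sum_subtractf)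
      ultimately obtain v where v: "(\<Sum>e\<in>G - F. cscale (c e - d e) e) = (\<Sum>f\<in>F. cscale (v f) f)"
        using F(3) chain.span_finite[OF finF] by auto
      define w where "w g = (if g \<in> F then - v g else c g - d g)" for g
      have "(\<Sum>g\<in>G. cscale (w g) g) = (\<Sum>g\<in>G - F. cscale (w g) g) + (\<Sum>g\<in>F. cscale (w g) g)"
        using sum.subset_diff[OF G(1) finG] by blast
      also have "(\<Sum>g\<in>G - F. cscale (w g) g) = (\<Sum>e\<in>G - F. cscale (c e - d e) e)"
        by (rule sum.cong) (auto simp: w_def)
      also have "(\<Sum>g\<in>F. cscale (w g) g) = - (\<Sum>f\<in>F. cscale (v f) f)"
        by (simp add: w_def sum_negf)
      finally have "(\<Sum>g\<in>G. cscale (w g) g) = 0" using v by simp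
      then have "w g = 0" if "g \<in> G" for g
        using chain.independentD[OF G(3) finG subset_refl] that by blast
      then have "d e = c e" if "e \<in> G - F" for e
        using that by (metis DiffD1 DiffD2 eq_iff_diff_eq_0 w_def)
      moreover have "d e = c e" if "e \<notin> G - F" for e
        using that d by (auto simp: c_def)
      ultimately show "d = c" by blast
    qed
  qed
  then have "quotient_basis Z B (G - F)"
    using finG G(2) by (auto simp: quotient_basis_def)
  then show ?thesis ..
qed

lemma quotient_dim_add:
  fixes Z B :: "('b \<Rightarrow>\<^sub>0 'k::field) set"
  assumes "chain.subspace Z" "chain.subspace B" "B \<subseteq> Z" "finite K" "Z \<subseteq> chain.span K"
  shows "quotient_dim Z B + chain.dim B = chain.dim Z"
  unfolding quotient_dim_def
  using quotient_basis_card[OF assms someI_ex[OF quotient_basis_exists[OF assms]]] by simp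


section \<open>Order chains and the differential\<close>

definition order_chains :: "int \<Rightarrow> 'a::order set \<Rightarrow> 'a list set" where
  "order_chains k P = {xs. int (length xs) = k + 1 \<and> set xs \<subseteq> P \<and> sorted_wrt (>) xs}"

definition C_chains :: "'a::order set \<Rightarrow> int \<Rightarrow> ('a, 'k::field) chain set" where
  "C_chains P k = {c. Poly_Mapping.keys c \<subseteq> order_chains k P}"

definition delete_nth :: "nat \<Rightarrow> 'a list \<Rightarrow> 'a list" where
  "delete_nth j xs = take j xs @ drop (Suc j) xs"

definition boundary :: "('a, 'k::field) chain \<Rightarrow> ('a, 'k) chain" where
  \<comment> \<open>The differential in all degrees at once; it is \<open>0\<close> on the empty chain.\<close>
  "boundary = lin_ext (\<lambda>xs. \<Sum>j<length xs. Poly_Mapping.single (delete_nth j xs) ((- 1) ^ j))"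

definition proj_order :: "('a::order, 'k::field) chain \<Rightarrow> ('a, 'k) chain" where
  \<comment> \<open>The map \<open>\<pi>\<close>: a multichain has no repetitions iff it is strictly decreasing.\<close>
  "proj_order = lin_ext (\<lambda>xs. if sorted_wrt (>) xs then Poly_Mapping.single xs 1 else 0)"


section \<open>Homology\<close>

text \<open>
  A complex is a family \<open>D\<close> of subspaces of formal combinations, closed under
  \<^const>\<open>boundary\<close>. Homology classes are cosets. Relative homology is presented, as in
  singular homology in the library, by relative cycles modulo relative boundaries.
\<close>

definition cycles :: "(int \<Rightarrow> ('a, 'k::field) chain set) \<Rightarrow> int \<Rightarrow> ('a, 'k) chain set" where
  "cycles D k = {z \<in> D k. boundary z = 0}"

definition boundaries :: "(int \<Rightarrow> ('a, 'k::field) chain set) \<Rightarrow> int \<Rightarrow> ('a, 'k) chain set" where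
  "boundaries D k = boundary ` D (k + 1)"

definition homology_class ::
  "(int \<Rightarrow> ('a, 'k::field) chain set) \<Rightarrow> int \<Rightarrow> ('a, 'k) chain \<Rightarrow> ('a, 'k) chain set" where
  "homology_class D k z = {z + b |b. b \<in> boundaries D k}"

definition homology :: "(int \<Rightarrow> ('a, 'k::field) chain set) \<Rightarrow> int \<Rightarrow> ('a, 'k) chain set set" where
  "homology D k = homology_class D k ` cycles D k"

definition homology_dim :: "(int \<Rightarrow> ('a, 'k::field) chain set) \<Rightarrow> int \<Rightarrow> nat" where
  "homology_dim D k = quotient_dim (cycles D k) (boundaries D k)"

definition inclusion_induces_iso ::
  "(int \<Rightarrow> ('a, 'k::field) chain set) \<Rightarrow> (int \<Rightarrow> ('a, 'k) chain set) \<Rightarrow> bool" where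
  \<comment> \<open>The induced map sends the class of \<open>z\<close> in \<open>D\<close> to the class of \<open>z\<close> in \<open>D'\<close>. It is
    always linear, so it is an isomorphism iff it is bijective.\<close>
  "inclusion_induces_iso D D' \<longleftrightarrow>
     (\<forall>k. D k \<subseteq> D' k) \<and>
     (\<forall>k. bij_betw (\<lambda>h. \<Union>z\<in>h. homology_class D' k z) (homology D k) (homology D' k))"

definition rel_cycles :: "int \<Rightarrow> 'a::order set \<Rightarrow> 'a set \<Rightarrow> ('a, 'k::field) chain set" where
  "rel_cycles k P Q = {z \<in> C_chains P k. boundary z \<in> C_chains Q (k - 1)}"

definition rel_boundaries :: "int \<Rightarrow> 'a::order set \<Rightarrow> 'a set \<Rightarrow> ('a, 'k::field) chain set" where
  "rel_boundaries k P Q = {boundary w + q |w q. w \<in> C_chains P (k + 1) \<and> q \<in> C_chains Q k}"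

definition homologous_rel ::
  "int \<Rightarrow> 'a::order set \<Rightarrow> 'a set \<Rightarrow> ('a, 'k::field) chain \<Rightarrow> ('a, 'k) chain \<Rightarrow> bool" where
  "homologous_rel k P Q z z' \<longleftrightarrow>
     z \<in> rel_cycles k P Q \<and> z' \<in> rel_cycles k P Q \<and> z - z' \<in> rel_boundaries k P Q"


section \<open>Synor complexes\<close>

definition C_top :: "'a::order set \<Rightarrow> int \<Rightarrow> 'a \<Rightarrow> ('a, 'k::field) chain set" where
  "C_top P i x = {c \<in> C_chains P i. \<forall>xs\<in>Poly_Mapping.keys c. xs \<noteq> [] \<and> hd xs = x}"

definition synor_sub ::
  "(int \<Rightarrow> 'a \<Rightarrow> ('a, 'k::field) chain set) \<Rightarrow> 'a set \<Rightarrow> int \<Rightarrow> ('a, 'k) chain set" where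
  \<comment> \<open>The subcomplex of a synor complex with summands \<open>S i x\<close> given by a set \<open>J\<close> of elements.
    The sum over \<open>x\<close> is direct because the chains in \<open>S i x\<close> have largest element \<open>x\<close>.\<close>
  "synor_sub S J i =
     (if i \<ge> 0 then chain.span (\<Union>x\<in>J. S i x)
      else if i = - 1 then chain.span {Poly_Mapping.single [] 1}
      else {0})"

definition order_ideal :: "'a::order set \<Rightarrow> 'a set \<Rightarrow> bool" where
  "order_ideal P J \<longleftrightarrow> J \<subseteq> P \<and> (\<forall>x\<in>J. \<forall>y\<in>P. y \<le> x \<longrightarrow> y \<in> J)"

locale synor_complex =
  fixes P :: "'a::order set"
    and S :: "int \<Rightarrow> 'a \<Rightarrow> ('a, 'k::field) chain set"
  assumes finite_poset: "finite P"
    and subspace: "\<lbrakk>i \<ge> 0; x \<in> P\<rbrakk> \<Longrightarrow> chain.subspace (S i x)"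
    and subset_C_top: "\<lbrakk>i \<ge> 0; x \<in> P\<rbrakk> \<Longrightarrow> S i x \<subseteq> C_top P i x"
    and boundary_S: "\<lbrakk>i \<ge> 1; x \<in> P\<rbrakk> \<Longrightarrow> boundary ` S i x \<subseteq> synor_sub S {y \<in> P. y < x} (i - 1)"
    and S1: "\<lbrakk>i \<ge> 0; x \<in> P\<rbrakk> \<Longrightarrow> chain.dim (S i x) =
      homology_dim (C_chains {y \<in> P. y < x} :: int \<Rightarrow> ('a, 'k) chain set) (i - 1)"
    and S2: "order_ideal P J \<Longrightarrow> inclusion_induces_iso (synor_sub S J) (C_chains J)"

definition principal_synor_chain ::
  "'a::order set \<Rightarrow> (int \<Rightarrow> 'a \<Rightarrow> ('a, 'k::field) chain set) \<Rightarrow> int \<Rightarrow> 'a \<Rightarrow> ('a, 'k) chain \<Rightarrow> bool"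
  where "principal_synor_chain P S m x \<gamma> \<longleftrightarrow> m \<ge> 0 \<and> x \<in> P \<and> \<gamma> \<in> S m x"


section \<open>Representations\<close>

definition concat_chain :: "'a list \<Rightarrow> ('a, 'k::field) chain \<Rightarrow> ('a, 'k) chain" where
  "concat_chain \<chi> = lin_ext (\<lambda>ys. Poly_Mapping.single (\<chi> @ ys) 1)"

definition initial_segments :: "nat \<Rightarrow> ('a, 'k::field) chain \<Rightarrow> 'a list set" where
  \<comment> \<open>The set \<open>X\<^sub>l\<close> of initial segments \<open>(x\<^sub>0 > \<dots> > x\<^sub>l)\<close>, which have \<open>l + 1\<close> entries.\<close>
  "initial_segments l \<gamma> = take (Suc l) ` Poly_Mapping.keys \<gamma>"

definition is_representation ::
  "'a::order set \<Rightarrow> nat \<Rightarrow> nat \<Rightarrow> ('a, 'k::field) chain \<Rightarrow> ('a list \<Rightarrow> ('a, 'k) chain) \<Rightarrow> bool" where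
  "is_representation P m l \<gamma> \<zeta> \<longleftrightarrow>
     (\<forall>\<chi>\<in>initial_segments l \<gamma>. \<zeta> \<chi> \<in> C_chains {y \<in> P. y < last \<chi>} (int m - int l - 1)) \<and>
     \<gamma> = (\<Sum>\<chi>\<in>initial_segments l \<gamma>. concat_chain \<chi> (\<zeta> \<chi>))"


section \<open>The maps \<open>\<rho>\<close>\<close>

locale synor_retraction =
  fixes P :: "'a::order set"
    and S :: "int \<Rightarrow> 'a \<Rightarrow> ('a, 'k::field) chain set"
    and \<rho> :: "int \<Rightarrow> ('a, 'k) chain \<Rightarrow> ('a, 'k) chain"
  assumes add: "\<lbrakk>k \<ge> - 2; a \<in> C_chains P k; b \<in> C_chains P k\<rbrakk> \<Longrightarrow> \<rho> k (a + b) = \<rho> k a + \<rho> k b"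
    and scale: "\<lbrakk>k \<ge> - 2; a \<in> C_chains P k\<rbrakk> \<Longrightarrow> \<rho> k (cscale r a) = cscale r (\<rho> k a)"
    and range: "\<lbrakk>k \<ge> - 2; a \<in> C_chains P k\<rbrakk> \<Longrightarrow> \<rho> k a \<in> synor_sub S P k"
    and empty: "\<rho> (- 1) (Poly_Mapping.single [] 1) = Poly_Mapping.single [] 1"
    and chain_map: "\<lbrakk>k \<ge> - 1; a \<in> C_chains P k\<rbrakk> \<Longrightarrow> \<rho> (k - 1) (boundary a) = boundary (\<rho> k a)"
    and support: "\<lbrakk>k \<ge> 0; c \<in> order_chains k P\<rbrakk> \<Longrightarrow>
      \<rho> k (Poly_Mapping.single c 1) \<in> C_chains {y \<in> P. y \<le> hd c} k"


section \<open>Shuffle product\<close>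

fun join_tails :: "'a::lattice list \<Rightarrow> 'a list" where
  \<comment> \<open>The map \<open>\<tau>\<close>.\<close>
  "join_tails [] = []"
| "join_tails (a # as) = Sup_fin (set (a # as)) # join_tails as"

definition shuffle_perms :: "nat \<Rightarrow> nat \<Rightarrow> (nat \<Rightarrow> nat) set" where
  \<comment> \<open>Indexed by the numbers of entries \<open>p = i + 1\<close>, \<open>q = j + 1\<close> of the two multichains.\<close>
  "shuffle_perms p q = {\<sigma>. \<sigma> permutes {..<p + q} \<and>
     strict_mono_on {..<p} (inv \<sigma>) \<and> strict_mono_on {p..<p + q} (inv \<sigma>)}"

definition shuffle_lists :: "'a::lattice list \<Rightarrow> 'a list \<Rightarrow> ('a, 'k::field) chain" where
  "shuffle_lists xs ys = (\<Sum>\<sigma>\<in>shuffle_perms (length xs) (length ys).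
     Poly_Mapping.single (join_tails (permute_list \<sigma> (xs @ ys))) (of_int (sign \<sigma>)))"

definition shuffle_product ::
  "('a::lattice, 'k::field) chain \<Rightarrow> ('a, 'k) chain \<Rightarrow> ('a, 'k) chain" where
  "shuffle_product c d = lin_ext (\<lambda>xs. lin_ext (\<lambda>ys. shuffle_lists xs ys) d) c"


section \<open>Proper parts of a lattice\<close>

definition Lbar :: "'a::bounded_lattice set" where
  "Lbar = UNIV - {bot}"

definition Lcheck :: "'a::bounded_lattice set" where
  "Lcheck = UNIV - {bot, top}"

end

theory Submission
  imports Defs
begin

text \<open>
  Modulo degenerate multichains, the shuffle product satisfies the Leibniz rule, and
  the shuffle of \<open>\<chi>\<close> and \<open>b\<close> reduces to the concatenation \<open>\<chi> * b\<close> when \<open>b\<close> lies below \<open>min \<chi>\<close>,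
  because a join with a smaller element repeats an entry. Hence \<open>\<gamma>\<close> equals the sum of the shuffles of
  \<open>\<chi>\<close> and \<open>\<zeta>\<^sub>\<chi>\<close>.

  As \<open>P\<^sub>\<le>\<^sub>x\<close> is a cone with apex \<open>x\<close>, there is a homotopy \<open>h\<close> from \<open>\<rho>\<close> to the identity such that
  \<open>h c\<close> is supported below the largest element of \<open>c\<close>. Since \<open>\<zeta>\<^sub>\<chi>\<close> is a cycle, the Leibniz rule
  gives that \<open>\<gamma>\<close> minus the sum of the shuffles of \<open>\<rho> \<chi>\<close> and \<open>\<zeta>\<^sub>\<chi>\<close> is the boundary of the sum of
  the shuffles of \<open>h \<chi>\<close> and \<open>\<zeta>\<^sub>\<chi>\<close>, plus the sum of the shuffles of \<open>h (\<partial> \<chi>)\<close> and \<open>\<zeta>\<^sub>\<chi>\<close>. The last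
  sum is the image of \<open>\<partial> \<gamma>\<close> under the linear map that splits a chain \<open>b\<close> after \<open>l\<close> entries into
  \<open>b' * b''\<close> and sends it to the shuffle of \<open>h b'\<close> and \<open>b''\<close>; as \<open>\<partial> \<gamma>\<close> avoids the top element, so
  does this image.
\<close>

section \<open>Formal linear combinations\<close>

lemma lookup_sum_chain: "Poly_Mapping.lookup (sum f A) x = (\<Sum>a\<in>A. Poly_Mapping.lookup (f a) x)"
  by (induction A rule: infinite_finite_induct) (auto simp: Poly_Mapping.lookup_add)

lemma keys_cscale: "Poly_Mapping.keys (cscale c p) \<subseteq> Poly_Mapping.keys p"
  by (auto simp: in_keys_iff)

lemma cscale_single [simp]: "cscale c (Poly_Mapping.single x d) = Poly_Mapping.single x (c * d)"
  by (rule poly_mapping_eqI) (simp add: lookup_single when_def)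

lemma lin_ext_superset:
  assumes "finite K" "Poly_Mapping.keys p \<subseteq> K"
  shows "lin_ext f p = (\<Sum>x\<in>K. cscale (Poly_Mapping.lookup p x) (f x))"
  unfolding lin_ext_def using assms
  by (intro sum.mono_neutral_left) (auto simp: in_keys_iff)

lemma lin_ext_add [simp]: "lin_ext f (p + q) = lin_ext f p + lin_ext f q"
  using lin_ext_superset[of "Poly_Mapping.keys p \<union> Poly_Mapping.keys q" _ f] Poly_Mapping.keys_add[of p q]
  by (simp add: Poly_Mapping.lookup_add chain.scale_left_distrib sum.distrib)

lemma lin_ext_cscale [simp]: "lin_ext f (cscale c p) = cscale c (lin_ext f p)"
  using lin_ext_superset[of "Poly_Mapping.keys p" _ f] keys_cscale[of c p]
  by (simp add: chain.scale_sum_right)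

lemma lin_ext_zero [simp]: "lin_ext f 0 = 0"
  by (simp add: lin_ext_def)

lemma lin_ext_single [simp]: "lin_ext f (Poly_Mapping.single x c) = cscale c (f x)"
  by (cases "c = 0") (simp_all add: lin_ext_def)

lemma cscale_minus_one: "cscale (- 1) p = - p"
  using chain.scale_minus_left[of 1 p] by simp

lemma lin_ext_uminus [simp]: "lin_ext f (- p) = - lin_ext f p"
  using lin_ext_cscale[of f "-1" p] by (simp add: cscale_minus_one)

lemma lin_ext_diff [simp]: "lin_ext f (p - q) = lin_ext f p - lin_ext f q"
  using lin_ext_add[of f p "- q"] by simp

lemma lin_ext_sum [simp]: "lin_ext f (sum g A) = (\<Sum>a\<in>A. lin_ext f (g a))"
  by (induction A rule: infinite_finite_induct) auto

lemma lin_ext_cong: "(\<And>x. x \<in> Poly_Mapping.keys p \<Longrightarrow> f x = g x) \<Longrightarrow> lin_ext f p = lin_ext g p"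
  by (simp add: lin_ext_def)

lemma lin_ext_mem:
  assumes "chain.subspace V" "\<And>x. x \<in> Poly_Mapping.keys p \<Longrightarrow> f x \<in> V"
  shows "lin_ext f p \<in> V"
  unfolding lin_ext_def using assms
  by (intro chain.subspace_sum chain.subspace_scale) auto

lemma chain_sum_keys:
  "p = (\<Sum>x\<in>Poly_Mapping.keys p. Poly_Mapping.single x (Poly_Mapping.lookup p x))"
  by (rule poly_mapping_eqI)
    (simp add: lookup_sum_chain lookup_single when_def in_keys_iff if_distrib cong: if_cong)

text \<open>The bound \<open>K\<close> on the keys lets degree and support enter the basis case.
  Bilinear identities for shuffles follow by using this once in each argument.\<close>

lemma chain_induct [consumes 1, case_names zero single add scale]:
  assumes "Poly_Mapping.keys p \<subseteq> K" "P 0"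
    and single: "\<And>x. x \<in> K \<Longrightarrow> P (Poly_Mapping.single x 1)"
    and add: "\<And>a b. P a \<Longrightarrow> P b \<Longrightarrow> P (a + b)"
    and scale: "\<And>r a. P a \<Longrightarrow> P (cscale r a)"
  shows "P p"
proof -
  have "P (\<Sum>x\<in>A. Poly_Mapping.single x (Poly_Mapping.lookup p x))"
    if "finite A" "A \<subseteq> K" for A
    using that
  proof induction
    case empty
    then show ?case using assms(2) by simp
  next
    case (insert x A)
    then show ?case using add[OF scale[OF single[of x], of "Poly_Mapping.lookup p x"]] by simp
  qed
  from this[of "Poly_Mapping.keys p"] show ?thesis
    using assms(1) by (simp flip: chain_sum_keys)
qed

lemma lin_ext_single_id [simp]: "lin_ext (\<lambda>x. Poly_Mapping.single x 1) p = p"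
  using chain_sum_keys[of p] by (simp add: lin_ext_def)

lemma lin_ext_fun_add: "lin_ext (\<lambda>x. f x + g x) p = lin_ext f p + lin_ext g p"
  by (simp add: lin_ext_def chain.scale_right_distrib sum.distrib)

lemma lin_ext_fun_diff: "lin_ext (\<lambda>x. f x - g x) p = lin_ext f p - lin_ext g p"
  by (simp add: lin_ext_def chain.scale_right_diff_distrib sum_subtractf)

lemma lin_ext_fun_cscale: "lin_ext (\<lambda>x. cscale c (f x)) p = cscale c (lin_ext f p)"
  by (simp add: lin_ext_def chain.scale_sum_right mult.commute)

lemma lin_ext_fun_zero: "lin_ext (\<lambda>x. 0) p = 0"
  by (simp add: lin_ext_def)

lemma lin_ext_lin_ext: "lin_ext f (lin_ext g p) = lin_ext (\<lambda>x. lin_ext f (g x)) p"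
  by (simp add: lin_ext_def[of g] lin_ext_def[of "\<lambda>x. lin_ext f (g x)"])

section \<open>Order chains\<close>

lemma subspace_C_chains: "chain.subspace (C_chains A k :: ('a::order, 'b::field) chain set)"
  unfolding chain.subspace_def C_chains_def
proof (intro conjI ballI allI; clarsimp)
  fix p q :: "'a list \<Rightarrow>\<^sub>0 'b" and x
  assume "Poly_Mapping.keys p \<subseteq> order_chains k A" "Poly_Mapping.keys q \<subseteq> order_chains k A"
    and "x \<in> Poly_Mapping.keys (p + q)"
  then show "x \<in> order_chains k A"
    using Poly_Mapping.keys_add[of p q] by blast
next
  fix c :: 'b and p :: "'a list \<Rightarrow>\<^sub>0 'b" and x
  assume "Poly_Mapping.keys p \<subseteq> order_chains k A" "x \<in> Poly_Mapping.keys (cscale c p)"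
  then show "x \<in> order_chains k A"
    using keys_cscale[of c p] by blast
qed

lemma single_in_C_chains [simp]:
  "Poly_Mapping.single x (1 :: 'k::field) \<in> C_chains A k \<longleftrightarrow> x \<in> order_chains k A"
  by (simp add: C_chains_def)

lemma order_chains_mono: "A \<subseteq> B \<Longrightarrow> order_chains k A \<subseteq> order_chains k B"
  by (auto simp: order_chains_def)

lemma C_chains_mono: "A \<subseteq> B \<Longrightarrow> C_chains A k \<subseteq> C_chains B k"
  using order_chains_mono[of A B k] by (auto simp: C_chains_def)

lemmas C_chains_closed =
  chain.subspace_0[OF subspace_C_chains] chain.subspace_add[OF subspace_C_chains]
  chain.subspace_scale[OF subspace_C_chains] chain.subspace_neg[OF subspace_C_chains]
  chain.subspace_diff[OF subspace_C_chains]
  chain.subspace_sum[OF subspace_C_chains]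

lemma lin_ext_C_chains:
  assumes "p \<in> C_chains A k" "\<And>x. x \<in> order_chains k A \<Longrightarrow> f x \<in> C_chains B j"
  shows "lin_ext f p \<in> C_chains B j"
  using assms by (intro lin_ext_mem[OF subspace_C_chains]) (auto simp: C_chains_def)

lemma Cons_in_order_chains:
  "x # xs \<in> order_chains k A \<longleftrightarrow> x \<in> A \<and> xs \<in> order_chains (k - 1) {y \<in> A. y < x}"
  by (auto simp: order_chains_def)

lemma Nil_in_order_chains: "[] \<in> order_chains k A \<longleftrightarrow> k = - 1"
  by (auto simp: order_chains_def)

section \<open>The differential\<close>

lemma lin_ext_concat_single [simp]:
  "lin_ext f (concat_chain xs p) = lin_ext (\<lambda>ys. f (xs @ ys)) p"
  by (simp add: concat_chain_def lin_ext_lin_ext)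

lemma concat_chain_simps [simp]:
  "concat_chain xs (Poly_Mapping.single ys c) = Poly_Mapping.single (xs @ ys) c"
  "concat_chain xs (p + q) = concat_chain xs p + concat_chain xs q"
  "concat_chain xs (p - q) = concat_chain xs p - concat_chain xs q"
  "concat_chain xs (- p) = - concat_chain xs p"
  "concat_chain xs (cscale r p) = cscale r (concat_chain xs p)"
  "concat_chain xs 0 = 0"
  "concat_chain xs (sum g I) = (\<Sum>i\<in>I. concat_chain xs (g i))"
  "concat_chain [] p = p"
  "concat_chain xs (concat_chain zs p) = concat_chain (xs @ zs) p"
  by (simp_all add: concat_chain_def lin_ext_lin_ext)

lemma boundary_linear [simp]:
  "boundary (p + q) = boundary p + boundary q"
  "boundary (p - q) = boundary p - boundary q"
  "boundary (- p) = - boundary p"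
  "boundary (cscale r p) = cscale r (boundary p)"
  "boundary 0 = 0"
  "boundary (sum g I) = (\<Sum>i\<in>I. boundary (g i))"
  by (simp_all add: boundary_def)

lemma boundary_lin_ext: "boundary (lin_ext f p) = lin_ext (\<lambda>x. boundary (f x)) p"
  by (simp add: boundary_def lin_ext_lin_ext)

lemma boundary_Nil [simp]: "boundary (Poly_Mapping.single [] c) = 0"
  by (simp add: boundary_def)

text \<open>Deleting the head leaves \<open>xs\<close>. Every other face keeps \<open>x\<close> in
  front and has the index it had in \<open>xs\<close> raised by one, hence the minus sign.\<close>

lemma boundary_Cons_single:
  "boundary (Poly_Mapping.single (x # xs) 1) =
     Poly_Mapping.single xs 1 - concat_chain [x] (boundary (Poly_Mapping.single xs 1))"
proof -
  have "(\<Sum>j<length (x # xs). Poly_Mapping.single (delete_nth j (x # xs)) ((- 1 :: 'b) ^ j)) =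
    Poly_Mapping.single xs 1 +
    (\<Sum>j<length xs. Poly_Mapping.single (x # delete_nth j xs) (- ((- 1) ^ j)))"
    by (simp add: sum.lessThan_Suc_shift delete_nth_def del: sum.lessThan_Suc)
  then show ?thesis
    by (simp add: boundary_def single_uminus sum_negf)
qed

lemma boundary_concat_Cons:
  "boundary (concat_chain [x] p) = p - concat_chain [x] (boundary p)"
  by (induction p rule: chain_induct[OF subset_UNIV])
    (simp_all add: boundary_Cons_single chain.scale_right_diff_distrib)

lemma concat_chain_lin_ext: "concat_chain \<chi> (lin_ext f p) = lin_ext (\<lambda>x. concat_chain \<chi> (f x)) p"
  by (simp add: concat_chain_def lin_ext_lin_ext)

text \<open>Iterates \<open>boundary_concat_Cons\<close> along \<open>\<chi>\<close>. When
  \<open>p\<close> is a cycle, only the faces that delete an entry of \<open>\<chi>\<close>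
  remain.\<close>

lemma boundary_concat:
  "boundary (concat_chain \<chi> p) = lin_ext (\<lambda>a. concat_chain a p) (boundary (Poly_Mapping.single \<chi> 1))
     + cscale ((- 1) ^ length \<chi>) (concat_chain \<chi> (boundary p))"
proof (induction \<chi>)
  case (Cons x \<chi>)
  have "boundary (concat_chain (x # \<chi>) p) = boundary (concat_chain [x] (concat_chain \<chi> p))"
    by simp
  also have "\<dots> = concat_chain \<chi> p - concat_chain [x] (boundary (concat_chain \<chi> p))"
    by (rule boundary_concat_Cons)
  also have "\<dots> = concat_chain \<chi> p
      - lin_ext (\<lambda>a. concat_chain (x # a) p) (boundary (Poly_Mapping.single \<chi> 1))
      - cscale ((- 1) ^ length \<chi>) (concat_chain (x # \<chi>) (boundary p))"
    by (simp add: Cons.IH concat_chain_lin_ext)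
  finally show ?case by (simp add: boundary_Cons_single)
qed simp

lemma boundary_boundary_single: "boundary (boundary (Poly_Mapping.single xs 1)) = 0"
  by (induction xs) (simp_all add: boundary_Cons_single boundary_concat_Cons)

lemma boundary_boundary: "boundary (boundary p) = 0"
  using boundary_lin_ext[of "\<lambda>x. Poly_Mapping.single x 1" p]
    boundary_lin_ext[of "\<lambda>x. boundary (Poly_Mapping.single x 1)" p]
  by (simp add: boundary_boundary_single lin_ext_fun_zero)

text \<open>\<open>A\<close> is generalised because the tail lies among the elements of
  \<open>A\<close> below \<open>x\<close>; so do its faces, and \<open>x\<close> can be put in front
  of them again.\<close>

lemma boundary_single_C_chains:
  "xs \<in> order_chains k A \<Longrightarrow> boundary (Poly_Mapping.single xs (1 :: 'b::field)) \<in> C_chains A (k - 1)"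
proof (induction xs arbitrary: k A)
  case (Cons x xs)
  let ?B = "{y \<in> A. y < x}"
  have xs: "xs \<in> order_chains (k - 1) ?B" "x \<in> A"
    using Cons.prems by (auto simp: Cons_in_order_chains)
  have "concat_chain [x] (boundary (Poly_Mapping.single xs (1 :: 'b))) \<in> C_chains A (k - 1)"
    unfolding concat_chain_def
    by (rule lin_ext_C_chains[where k = "k - 1 - 1"])
      (use Cons.IH[OF xs(1)] xs(2) in \<open>simp_all add: Cons_in_order_chains\<close>)
  moreover have "xs \<in> order_chains (k - 1) A"
    using xs(1) order_chains_mono[of ?B A] by blast
  ultimately show ?case
    by (simp add: boundary_Cons_single C_chains_closed)
qed (simp add: C_chains_closed)

lemma boundary_C_chains: "p \<in> C_chains A k \<Longrightarrow> boundary p \<in> C_chains A (k - 1)"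
  using boundary_lin_ext[of "\<lambda>x. Poly_Mapping.single x 1" p]
  by (simp add: lin_ext_C_chains boundary_single_C_chains)

section \<open>Normalised cones\<close>

text \<open>
  Dropping the chains with largest element \<open>z\<close> instead of repeating \<open>z\<close> makes the cone operator
  compatible with \<open>\<pi>\<close>; it is still a contraction of the chains supported below \<open>z\<close>.
\<close>

definition cone :: "'a::order \<Rightarrow> ('a, 'k::field) chain \<Rightarrow> ('a, 'k) chain" where
  "cone z = lin_ext (\<lambda>xs. if xs = [] \<or> hd xs < z then Poly_Mapping.single (z # xs) 1 else 0)"

lemma cone_linear [simp]:
  "cone z (p + q) = cone z p + cone z q"
  "cone z (p - q) = cone z p - cone z q"
  "cone z (- p) = - cone z p"
  "cone z (cscale r p) = cscale r (cone z p)"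
  "cone z 0 = 0"
  by (simp_all add: cone_def)

lemma cone_concat [simp]:
  "cone z (concat_chain (x # xs) p) = (if x < z then concat_chain (z # x # xs) p else 0)"
  by (simp add: cone_def concat_chain_def lin_ext_lin_ext lin_ext_fun_zero)

lemma cone_eq_concat:
  assumes "p \<in> C_chains {y. y < z} k"
  shows "cone z p = concat_chain [z] p"
  unfolding cone_def concat_chain_def
proof (rule lin_ext_cong)
  fix xs assume "xs \<in> Poly_Mapping.keys p"
  then have "set xs \<subseteq> {y. y < z}" using assms by (auto simp: C_chains_def order_chains_def)
  then have "xs = [] \<or> hd xs < z" by (cases xs) auto
  then show "(if xs = [] \<or> hd xs < z then Poly_Mapping.single (z # xs) 1 else 0) =
      Poly_Mapping.single ([z] @ xs) 1" by simp
qed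

lemma cone_C_chains:
  assumes "p \<in> C_chains {y \<in> A. y \<le> z} k" "z \<in> A"
  shows "cone z p \<in> C_chains {y \<in> A. y \<le> z} (k + 1)"
  unfolding cone_def
proof (rule lin_ext_C_chains[OF assms(1)])
  fix xs assume xs: "xs \<in> order_chains k {y \<in> A. y \<le> z}"
  show "(if xs = [] \<or> hd xs < z then Poly_Mapping.single (z # xs) 1 else 0)
      \<in> C_chains {y \<in> A. y \<le> z} (k + 1)"
    using xs assms(2) by (cases xs) (auto simp: C_chains_closed order_chains_def)
qed

text \<open>For a chain starting strictly below \<open>z\<close> this is the usual cone formula. For
  a chain starting at \<open>z\<close> the cone vanishes, and so does the right side: only the face
  that deletes \<open>z\<close> has a nonzero cone, and that cone is the chain itself.\<close>

lemma boundary_cone: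
  fixes p :: "('a::order, 'b::field) chain"
  assumes "p \<in> C_chains {y. y \<le> z} k"
  shows "boundary (cone z p) = p - cone z (boundary p)"
proof -
  have basis: "boundary (cone z (Poly_Mapping.single xs (1 :: 'b))) =
      Poly_Mapping.single xs 1 - cone z (boundary (Poly_Mapping.single xs 1))"
    if xs: "xs \<in> order_chains k {y. y \<le> z}" for xs
  proof (cases xs)
    case Nil
    then show ?thesis by (simp add: cone_def boundary_Cons_single)
  next
    case (Cons x ys)
    let ?s = "Poly_Mapping.single ys (1 :: 'b)"
    have below: "set ys \<subseteq> {y. y < x}" "x \<le> z" and ys: "ys \<in> order_chains (k - 1) {y. y < x}"
      using xs Cons by (auto simp: order_chains_def)
    have cs: "cone x ?s = concat_chain [x] ?s"
      using ys by (intro cone_eq_concat[of _ _ "k - 1"]) simp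
    show ?thesis
    proof (cases "x < z")
      case True
      then have "{y. y < x} \<subseteq> {y. y < z}" by (auto intro: less_trans)
      then have ys': "ys \<in> order_chains (k - 1) {y. y < z}"
        using ys order_chains_mono by blast
      then have "cone z ?s = concat_chain [z] ?s" 
        by (intro cone_eq_concat[of _ _ "k - 1"]) simp
      moreover have "cone z (Poly_Mapping.single (x # ys) (1 :: 'b)) = Poly_Mapping.single (z # x # ys) 1"
        using True by (simp add: cone_def)
      ultimately show ?thesis using True Cons
        by (simp add: boundary_Cons_single)
    next
      case False
      then have "z = x" using below by simp
      then show ?thesis using Cons cs
        by (simp add: boundary_Cons_single) (simp add: cone_def)
    qed
  qed
  have "Poly_Mapping.keys p \<subseteq> order_chains k {y. y \<le> z}"
    using assms by (simp add: C_chains_def)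
  then show ?thesis
    by (induction p rule: chain_induct) (simp_all add: basis chain.scale_right_diff_distrib)
qed

section \<open>Shuffle permutations\<close>

text \<open>
  Every permutation of \<open>{0, \<dots>, n}\<close> is uniquely \<open>move_to_front r \<circ> lift_perm p\<close>. It is a shuffle iff
  \<open>r\<close> is the first index of one of the two blocks and \<open>p\<close> is a shuffle of what remains, which yields
  the recursion \<open>(x # xs) \<cdot> (y # ys) = (x \<squnion> y) * (xs \<cdot> (y # ys) \<plusminus> (x # xs) \<cdot> ys)\<close> for shuffle
  products.
\<close>

lemma bij_imp_permutes_outside: "bij p \<Longrightarrow> (\<And>x. x \<notin> A \<Longrightarrow> p x = x) \<Longrightarrow> p permutes A"
  by (auto simp: permutes_def bij_iff)

lemma permutation_if_permutes: "p permutes {..<n::nat} \<Longrightarrow> permutation p"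
  using permutation_permutes finite_lessThan by blast

definition lift_perm :: "(nat \<Rightarrow> nat) \<Rightarrow> nat \<Rightarrow> nat" where
  "lift_perm f n = (case n of 0 \<Rightarrow> 0 | Suc i \<Rightarrow> Suc (f i))"

text \<open>The cycle that sends 0 to \<open>n\<close> and each of 1, ..., \<open>n\<close> to its
  predecessor; reindexing a list by it brings entry \<open>n\<close> to the front. Built from
  \<open>n\<close> adjacent transpositions, it has an evident sign.\<close>

primrec move_to_front :: "nat \<Rightarrow> nat \<Rightarrow> nat" where
  "move_to_front 0 = id"
| "move_to_front (Suc n) = transpose n (Suc n) \<circ> move_to_front n"

lemma lift_perm_simps [simp]: "lift_perm f 0 = 0" "lift_perm f (Suc i) = Suc (f i)"
  by (simp_all add: lift_perm_def)

lemma lift_perm_comp: "lift_perm (f \<circ> g) = lift_perm f \<circ> lift_perm g"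
  by (auto simp: lift_perm_def split: nat.splits)

lemma lift_perm_id [simp]: "lift_perm id = id"
  by (auto simp: lift_perm_def split: nat.splits)

lemma lift_perm_inject: "lift_perm f = lift_perm g \<longleftrightarrow> f = g"
proof
  assume "lift_perm f = lift_perm g"
  then have "lift_perm f (Suc i) = lift_perm g (Suc i)" for i by simp
  then show "f = g" by auto
qed simp

lemma lift_perm_transpose: "lift_perm (transpose a b) = transpose (Suc a) (Suc b)"
  by (auto simp: lift_perm_def transpose_def split: nat.splits)

lemma lift_perm_permutes:
  assumes "p permutes {..<n}"
  shows "lift_perm p permutes {..<Suc n}"
proof (rule bij_imp_permutes_outside)
  have "bij p" using assms by (rule permutes_bij)
  then have "lift_perm p \<circ> lift_perm (inv p) = id" "lift_perm (inv p) \<circ> lift_perm p = id"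
    by (simp_all flip: lift_perm_comp add: bij_is_surj bij_is_inj surj_iff[THEN iffD1])
  then show "bij (lift_perm p)" by (metis o_bij)
next
  fix x assume "x \<notin> {..<Suc n}"
  then show "lift_perm p x = x"
    using permutes_not_in[OF assms] by (cases x) auto
qed

text \<open>A product of transpositions lifts to a product of as many transpositions.\<close>

lemma sign_lift_perm:
  assumes "p permutes {..<n}"
  shows "sign (lift_perm p) = sign p"
  using finite_lessThan assms
proof (induction rule: permutes_rev_induct)
  case id
  show ?case by (simp only: lift_perm_id)
next
  case (swap a b p)
  have "permutation p" "permutation (lift_perm p)"
    by (rule permutation_if_permutes[OF swap.hyps(4)],
        rule permutation_if_permutes[OF lift_perm_permutes[OF swap.hyps(4)]])
  then show ?case
    using swap unfolding lift_perm_comp lift_perm_transpose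
    by (simp add: sign_compose sign_swap_id permutation_swap_id del: comp_apply)
qed

lemma move_to_front_simps [simp]:
  "move_to_front n 0 = n"
  "move_to_front n (Suc k) = (if k < n then k else Suc k)"
  by (induction n) (auto simp: transpose_def)

lemma move_to_front_permutes: "n < m \<Longrightarrow> move_to_front n permutes {..<m}"
proof (induction n)
  case (Suc n)
  then show ?case
    unfolding move_to_front.simps by (intro permutes_compose permutes_swap_id) auto
qed (simp add: permutes_id)

lemma sign_move_to_front: "sign (move_to_front n) = (- 1) ^ n"
proof (induction n)
  case (Suc n)
  have "permutation (move_to_front n)"
    using move_to_front_permutes[of n "Suc n"] permutation_permutes by blast
  then show ?case
    using Suc unfolding move_to_front.simps
    by (subst sign_compose) (simp_all add: sign_swap_id permutation_swap_id)
qed simp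

text \<open>Shuffles are defined by monotonicity of the inverse permutation, so the inverse is
  needed explicitly: index \<open>r\<close> goes to place 0, and every other index one place after
  where \<open>p\<close> puts it.\<close>

lemma inv_move_to_front_lift:
  assumes "p permutes {..<n}" "r \<le> n"
  shows "inv (move_to_front r \<circ> lift_perm p) k =
    (if k < r then Suc (inv p k) else if k = r then 0 else Suc (inv p (k - 1)))"
proof -
  have "bij (move_to_front r)" "bij (lift_perm p)"
    using assms move_to_front_permutes[of r "Suc n"] lift_perm_permutes permutes_bij by auto
  then have inj: "inj (move_to_front r \<circ> lift_perm p)"
    by (simp add: bij_is_inj inj_compose)
  have [simp]: "p (inv p i) = i" for i using permutes_inverses[OF assms(1)] by simp
  show ?thesis
    by (rule inv_f_eq[OF inj]) (use assms in \<open>cases k; simp\<close>)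
qed

text \<open>Undoing the move of \<open>s 0\<close> to the front leaves a permutation
  \<open>t\<close> that fixes 0, and such a permutation is a lift.\<close>

lemma permutes_eq_move_to_front_lift:
  assumes "s permutes {..<Suc n}"
  obtains p where "p permutes {..<n}" "s = move_to_front (s 0) \<circ> lift_perm p"
proof -
  have s0: "s 0 < Suc n" using permutes_in_image[OF assms, of 0] by simp
  define t where "t = inv (move_to_front (s 0)) \<circ> s"
  have mp: "move_to_front (s 0) permutes {..<Suc n}" by (rule move_to_front_permutes[OF s0])
  have t: "t permutes {..<Suc n}"
    unfolding t_def using assms mp by (intro permutes_compose permutes_inv)
  have s_eq: "s = move_to_front (s 0) \<circ> t"
    unfolding t_def by (simp add: o_assoc permutes_inv_o[OF mp])
  have t0: "t 0 = 0"
    by (simp add: t_def permutes_inv_eq[OF mp])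
  \<comment> \<open>The truncated subtraction loses nothing: \<open>t\<close> is injective and fixes
    0, so \<open>t (Suc i)\<close> is positive.\<close>
  define p where "p i = t (Suc i) - 1" for i
  have tS: "t (Suc i) \<noteq> 0" for i
    using t0 permutes_inj[OF t] by (metis inj_eq nat.distinct(1))
  have t_lift: "t = lift_perm p"
    using t0 tS by (auto simp: lift_perm_def p_def fun_eq_iff split: nat.splits)
  have "p permutes {..<n}"
  proof (rule bij_imp_permutes_outside)
    show "bij p"
    proof (rule bijI)
      show "inj p"
        by (rule injI) (metis t_lift lift_perm_simps(2) permutes_inj[OF t] inj_eq nat.inject)
      show "surj p"
      proof (rule surjI)
        fix i
        have "t (inv t (Suc i)) = Suc i" using permutes_inverses[OF t] by simp
        moreover from this t0 have "inv t (Suc i) \<noteq> 0" by (metis nat.distinct(1))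
        ultimately show "p (inv t (Suc i) - 1) = i"
          by (simp add: p_def)
      qed
    qed
  next
    fix x assume "x \<notin> {..<n}"
    then show "p x = x" using permutes_not_in[OF t, of "Suc x"] by (simp add: p_def)
  qed
  then show thesis by (rule that[OF _ s_eq[unfolded t_lift]])
qed

lemma move_to_front_lift_permutes:
  assumes "p permutes {..<n}" "r \<le> n"
  shows "move_to_front r \<circ> lift_perm p permutes {..<Suc n}"
  using assms by (intro permutes_compose lift_perm_permutes move_to_front_permutes) auto

lemma sign_move_to_front_lift:
  assumes "p permutes {..<n}"
  shows "sign (move_to_front r \<circ> lift_perm p) = (- 1) ^ r * sign p"
proof -
  have "permutation (move_to_front r)" "permutation (lift_perm p)"
    using permutation_if_permutes[OF move_to_front_permutes[OF lessI]]
      permutation_if_permutes[OF lift_perm_permutes[OF assms]] by simp_all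
  then show ?thesis
    by (simp add: sign_compose sign_move_to_front sign_lift_perm[OF assms])
qed

lemma inj_move_to_front_lift: "inj (\<lambda>p. move_to_front r \<circ> lift_perm p)"
proof (rule injI)
  fix p q assume eq: "move_to_front r \<circ> lift_perm p = move_to_front r \<circ> lift_perm q"
  have "inj (move_to_front r)"
    by (rule permutes_inj[OF move_to_front_permutes[OF lessI]])
  then have "lift_perm p i = lift_perm q i" for i
    using fun_cong[OF eq, of i] by (simp add: inj_eq)
  then have "lift_perm p = lift_perm q" ..
  then show "p = q" by (simp only: lift_perm_inject)
qed

section \<open>Recursive description of the set of shuffles\<close>

lemma strict_mono_on_Suc_image:
  assumes "\<And>i. i \<in> A \<Longrightarrow> f (Suc i) = Suc (g i)"
  shows "strict_mono_on (Suc ` A) f \<longleftrightarrow> strict_mono_on A g"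
  using assms by (simp add: monotone_on_def)

text \<open>Serves the block whose first index \<open>z\<close> moves to place 0: \<open>z\<close>
  is smallest both as an index and in value, so it adds no constraint.\<close>

lemma strict_mono_on_insert_Suc_image:
  fixes f g :: "nat \<Rightarrow> nat"
  assumes "\<And>i. i \<in> A \<Longrightarrow> f (Suc i) = Suc (g i)" "f z = 0" "\<And>i. i \<in> A \<Longrightarrow> z < Suc i"
  shows "strict_mono_on (insert z (Suc ` A)) f \<longleftrightarrow> strict_mono_on A g"
proof -
  have "\<not> Suc i < z" if "i \<in> A" for i using assms(3)[OF that] by simp
  then show ?thesis using assms by (simp add: monotone_on_def)
qed

lemma shuffle_perms_lift_left:
  assumes "p permutes {..<a + b}"
  shows "move_to_front 0 \<circ> lift_perm p \<in> shuffle_perms (Suc a) b \<longleftrightarrow> p \<in> shuffle_perms a b"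
    (is "?s \<in> _ \<longleftrightarrow> _")
proof -
  have inv: "inv ?s 0 = 0" "\<And>k. inv ?s (Suc k) = Suc (inv p k)"
    using inv_move_to_front_lift[OF assms, of 0] by simp_all
  have sets: "{..<Suc a} = insert 0 (Suc ` {..<a})" "{Suc a..<Suc a + b} = Suc ` {a..<a + b}"
    by (rule lessThan_Suc_eq_insert_0, simp only: image_Suc_atLeastLessThan add_Suc)
  have "strict_mono_on {..<Suc a} (inv ?s) \<longleftrightarrow> strict_mono_on {..<a} (inv p)"
    unfolding sets using inv by (intro strict_mono_on_insert_Suc_image) simp_all
  moreover have "strict_mono_on {Suc a..<Suc a + b} (inv ?s) \<longleftrightarrow> strict_mono_on {a..<a + b} (inv p)"
    unfolding sets using inv by (intro strict_mono_on_Suc_image) simp_all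
  ultimately show ?thesis
    using assms move_to_front_lift_permutes[OF assms, of 0]
    by (simp add: shuffle_perms_def)
qed

lemma shuffle_perms_lift_right:
  assumes "p permutes {..<a + b}"
  shows "move_to_front a \<circ> lift_perm p \<in> shuffle_perms a (Suc b) \<longleftrightarrow> p \<in> shuffle_perms a b"
    (is "?s \<in> _ \<longleftrightarrow> _")
proof -
  have inv: "inv ?s k = (if k < a then Suc (inv p k) else if k = a then 0 else Suc (inv p (k - 1)))" for k
    using inv_move_to_front_lift[OF assms, of a] by simp
  have "{a..<a + Suc b} = insert a {Suc a..<Suc (a + b)}"
    by auto
  then have sets: "{a..<a + Suc b} = insert a (Suc ` {a..<a + b})"
    by (simp only: image_Suc_atLeastLessThan)
  have "strict_mono_on {..<a} (inv ?s) \<longleftrightarrow> strict_mono_on {..<a} (inv p)"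
    by (auto simp: strict_mono_on_def inv)
  moreover have "strict_mono_on {a..<a + Suc b} (inv ?s) \<longleftrightarrow> strict_mono_on {a..<a + b} (inv p)"
    unfolding sets using inv by (intro strict_mono_on_insert_Suc_image) simp_all
  ultimately show ?thesis
    using assms move_to_front_lift_permutes[OF assms, of a]
    by (simp add: shuffle_perms_def)
qed

lemma shuffle_perms_Suc_Suc:
  "shuffle_perms (Suc a) (Suc b) =
     (\<lambda>p. move_to_front 0 \<circ> lift_perm p) ` shuffle_perms a (Suc b) \<union>
     (\<lambda>p. move_to_front (Suc a) \<circ> lift_perm p) ` shuffle_perms (Suc a) b" (is "?L = ?A \<union> ?B")
proof (intro Set.equalityI subsetI)
  fix s assume s: "s \<in> ?L"
  then have perm: "s permutes {..<Suc (a + Suc b)}" and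
    mono: "strict_mono_on {..<Suc a} (inv s)" "strict_mono_on {Suc a..<Suc a + Suc b} (inv s)"
    by (auto simp: shuffle_perms_def)
  obtain p where p: "p permutes {..<a + Suc b}" "s = move_to_front (s 0) \<circ> lift_perm p"
    using permutes_eq_move_to_front_lift[OF perm] .
  have "inv s (s 0) = 0" using permutes_inverses[OF perm] by simp
  moreover have "s 0 < Suc (a + Suc b)" using permutes_in_image[OF perm, of 0] by simp
  \<comment> \<open>The index \<open>s 0\<close> has inverse value 0, the least possible, so
    monotonicity makes it the first index of its block.\<close>
  ultimately have "s 0 = 0 \<or> s 0 = Suc a"
    using strict_mono_onD[OF mono(1), of 0 "s 0"] strict_mono_onD[OF mono(2), of "Suc a" "s 0"]
    by (cases "s 0 < Suc a"; cases "s 0 = Suc a") auto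
  then show "s \<in> ?A \<union> ?B"
  proof
    assume "s 0 = 0"
    then show ?thesis
      using p s shuffle_perms_lift_left[OF p(1)] by auto
  next
    assume "s 0 = Suc a"
    moreover have "p permutes {..<Suc a + b}" using p(1) by simp
    ultimately show ?thesis
      using p s shuffle_perms_lift_right[of p "Suc a" b] by auto
  qed
next
  fix s assume "s \<in> ?A \<union> ?B"
  then show "s \<in> ?L"
  proof
    assume "s \<in> ?A"
    then obtain p where p: "p \<in> shuffle_perms a (Suc b)" "s = move_to_front 0 \<circ> lift_perm p" by blast
    from p(1) have "p permutes {..<a + Suc b}" by (simp add: shuffle_perms_def)
    from shuffle_perms_lift_left[OF this] p show ?thesis by blast
  next
    assume "s \<in> ?B"
    then obtain p where p: "p \<in> shuffle_perms (Suc a) b" "s = move_to_front (Suc a) \<circ> lift_perm p" by blast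
    from p(1) have "p permutes {..<Suc a + b}" by (simp add: shuffle_perms_def)
    from shuffle_perms_lift_right[OF this] p show ?thesis by blast
  qed
qed

text \<open>Strong induction: the values below \<open>i\<close> are taken at themselves, so
  \<open>p i\<close> is not below \<open>i\<close>; and if \<open>i\<close> were the value at some
  larger \<open>j\<close>, monotonicity would give \<open>p i < i\<close>.\<close>

lemma strict_mono_on_permutes_id:
  assumes "p permutes {..<n::nat}" "strict_mono_on {..<n} p"
  shows "p = id"
proof -
  have "p i = i" if "i < n" for i
    using that
  proof (induction i rule: less_induct)
    case (less i)
    have inj: "inj p" using assms(1) by (rule permutes_inj)
    have "p i < n" using permutes_in_image[OF assms(1), of i] less.prems by simp
    have ge: "\<not> p i < i"
    proof
      assume "p i < i"
      then have "p (p i) = p i" using less by simp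
      then show False using inj \<open>p i < i\<close> by (metis inj_eq less_irrefl)
    qed
    define j where "j = inv p i"
    have pj: "p j = i" using permutes_inverses[OF assms(1)] by (simp add: j_def)
    have jn: "j < n" using permutes_in_image[OF assms(1), of j] less.prems pj by simp
    have "\<not> j < i" using less.IH[of j] jn pj by force
    moreover have "\<not> i < j"
      using assms(2) jn less.prems pj ge unfolding strict_mono_on_def by force
    ultimately show ?case using pj by (metis linorder_neqE_nat)
  qed
  moreover have "p i = i" if "\<not> i < n" for i using that permutes_not_in[OF assms(1)] by simp
  ultimately show ?thesis by (intro ext) (metis id_apply)
qed

lemma shuffle_perms_0: "shuffle_perms 0 n = {id}" "shuffle_perms n 0 = {id}"
proof -
  have "s = id" if "s permutes {..<n}" "strict_mono_on {..<n} (inv s)" for s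
    using strict_mono_on_permutes_id[OF permutes_inv[OF that(1)] that(2)] that(1)
    by (metis inv_id permutes_inv_inv)
  moreover have "strict_mono_on A (id :: nat \<Rightarrow> nat)" for A by (simp add: strict_mono_on_def)
  ultimately show "shuffle_perms 0 n = {id}" "shuffle_perms n 0 = {id}"
    by (auto simp: shuffle_perms_def permutes_id lessThan_atLeast0[symmetric])
qed

lemma permute_list_move_to_front_lift:
  assumes p: "p permutes {..<n}" and len: "length zs = Suc n" "r \<le> n"
  shows "permute_list (move_to_front r \<circ> lift_perm p) zs =
    (zs ! r) # permute_list p (take r zs @ drop (Suc r) zs)"
proof -
  have pn: "p i < n" if "i < n" for i using permutes_in_image[OF p, of i] that by simp
  have zs: "zs ! move_to_front r (Suc (p i)) = (take r zs @ drop (Suc r) zs) ! p i" if "i < n" for i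
    using len pn[OF that] by (simp add: nth_append)
  have "[0..<Suc n] = 0 # map Suc [0..<n]"
    by (simp only: map_Suc_upt upt_conv_Cons[OF zero_less_Suc] One_nat_def)
  then show ?thesis
    unfolding permute_list_def using len zs by (simp del: upt_Suc)
qed

lemma finite_shuffle_perms: "finite (shuffle_perms a b)"
  by (rule finite_subset[OF _ finite_permutations[of "{..<a + b}"]]) (auto simp: shuffle_perms_def)

section \<open>The normalised shuffle product\<close>

lemma Sup_fin_eqI:
  fixes x :: "'a::lattice"
  assumes "finite A" "\<And>a. a \<in> A \<Longrightarrow> a \<le> x" "\<And>u. (\<And>a. a \<in> A \<Longrightarrow> a \<le> u) \<Longrightarrow> x \<le> u" "A \<noteq> {}"
  shows "Sup_fin A = x"
  using assms by (intro order.antisym Sup_fin.boundedI) (auto intro: Sup_fin.coboundedI)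

lemma join_tails_sorted: "sorted_wrt (>) xs \<Longrightarrow> join_tails xs = xs"
proof (induction xs)
  case (Cons x xs)
  have "Sup_fin (set (x # xs)) = x"
    using Cons.prems by (intro Sup_fin_eqI) (auto simp: less_imp_le)
  then show ?case using Cons by simp
qed simp

lemma shuffle_lists_Nil [simp]:
  "shuffle_lists [] ys = Poly_Mapping.single (join_tails ys) 1"
  "shuffle_lists xs [] = Poly_Mapping.single (join_tails xs) 1"
  by (simp_all add: shuffle_lists_def shuffle_perms_0)

text \<open>The shuffles split according to whether \<open>x\<close> or \<open>y\<close> comes
  first. The total join is the same for every order of the entries, and moving \<open>y\<close> past
  the \<open>Suc (length xs)\<close> entries of \<open>x # xs\<close> costs the sign.\<close>

lemma shuffle_lists_Cons_Cons:
  fixes x y :: "'a::lattice"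
  shows "shuffle_lists (x # xs) (y # ys) =
    concat_chain [Sup_fin (set (x # xs @ y # ys))]
      (shuffle_lists xs (y # ys) + cscale ((- 1) ^ Suc (length xs)) (shuffle_lists (x # xs) ys)
        :: ('a, 'k::field) chain)"
proof -
  define a b where "a = length xs" and "b = length ys"
  let ?zs = "x # xs @ y # ys"
  let ?m = "\<lambda>r p. move_to_front r \<circ> lift_perm p"
  let ?J = "Sup_fin (set ?zs)"
  let ?t = "\<lambda>s. Poly_Mapping.single (join_tails (permute_list s ?zs)) (of_int (sign s)) :: ('a, 'k) chain"
  have disj: "?m 0 ` shuffle_perms a (Suc b) \<inter> ?m (Suc a) ` shuffle_perms (Suc a) b = {}"
  proof (rule ccontr)
    assume "\<not> ?thesis"
    then obtain p q where "?m 0 p = ?m (Suc a) q" by auto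
    then have "?m 0 p 0 = ?m (Suc a) q 0" by (rule fun_cong)
    then show False by simp
  qed
  have J: "Sup_fin (set (?zs ! r # permute_list p ws)) = ?J"
    if "p permutes {..<length ws}" "ws = take r ?zs @ drop (Suc r) ?zs" "r < length ?zs" for r p ws
  proof -
    have "set ?zs = set (take r ?zs @ ?zs ! r # drop (Suc r) ?zs)"
      using id_take_nth_drop[OF that(3)] by simp
    then show ?thesis using that by simp
  qed
  have left: "?t (?m 0 p) = concat_chain [?J]
      (Poly_Mapping.single (join_tails (permute_list p (xs @ y # ys))) (of_int (sign p)))"
    if "p \<in> shuffle_perms a (Suc b)" for p
  proof -
    have p: "p permutes {..<a + Suc b}" using that by (simp add: shuffle_perms_def)
    have "permute_list (?m 0 p) ?zs = x # permute_list p (xs @ y # ys)"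
      by (subst permute_list_move_to_front_lift[OF p]) (simp_all add: a_def b_def)
    moreover have "Sup_fin (set (x # permute_list p (xs @ y # ys))) = ?J"
      using J[of p "xs @ y # ys" 0] p by (simp add: a_def b_def)
    ultimately show ?thesis
      by (simp only: sign_move_to_front_lift[OF p] join_tails.simps concat_chain_simps(1) append_Cons
          append_Nil power_0 mult_1)
  qed
  have right: "?t (?m (Suc a) p) = concat_chain [?J] (cscale ((- 1) ^ Suc a)
      (Poly_Mapping.single (join_tails (permute_list p ((x # xs) @ ys))) (of_int (sign p))))"
    if "p \<in> shuffle_perms (Suc a) b" for p
  proof -
    have p: "p permutes {..<Suc a + b}" using that by (simp add: shuffle_perms_def)
    have "permute_list (?m (Suc a) p) ?zs = y # permute_list p ((x # xs) @ ys)"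
      by (subst permute_list_move_to_front_lift[OF p]) (simp_all add: a_def b_def)
    moreover have "Sup_fin (set (y # permute_list p ((x # xs) @ ys))) = ?J"
      using J[of p "(x # xs) @ ys" "Suc a"] p by (simp add: a_def b_def)
    ultimately show ?thesis
      by (simp only: sign_move_to_front_lift[OF p] join_tails.simps concat_chain_simps(1) append_Cons
          append_Nil cscale_single concat_chain_simps(5) of_int_mult of_int_power of_int_minus of_int_1)
  qed
  have "shuffle_lists (x # xs) (y # ys) = (\<Sum>s\<in>shuffle_perms (Suc a) (Suc b). ?t s)"
    by (simp add: shuffle_lists_def a_def b_def)
  also have "\<dots> = (\<Sum>s\<in>?m 0 ` shuffle_perms a (Suc b). ?t s)
      + (\<Sum>s\<in>?m (Suc a) ` shuffle_perms (Suc a) b. ?t s)"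
    unfolding shuffle_perms_Suc_Suc by (intro sum.union_disjoint finite_imageI finite_shuffle_perms disj)
  also have "\<dots> = (\<Sum>p\<in>shuffle_perms a (Suc b). ?t (?m 0 p))
      + (\<Sum>p\<in>shuffle_perms (Suc a) b. ?t (?m (Suc a) p))"
    by (intro arg_cong2[of _ _ _ _ "(+)"]
        sum.reindex_cong[OF inj_on_subset[OF inj_move_to_front_lift subset_UNIV] refl refl])
  also have "\<dots> = concat_chain [?J] (\<Sum>p\<in>shuffle_perms a (Suc b).
        Poly_Mapping.single (join_tails (permute_list p (xs @ y # ys))) (of_int (sign p)))
      + concat_chain [?J] (cscale ((- 1) ^ Suc a) (\<Sum>p\<in>shuffle_perms (Suc a) b.
        Poly_Mapping.single (join_tails (permute_list p ((x # xs) @ ys))) (of_int (sign p))))"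
    by (simp only: left right concat_chain_simps(7) chain.scale_sum_right cong: sum.cong)
  finally show ?thesis
    unfolding shuffle_lists_def concat_chain_simps(2) by (simp add: a_def b_def)
qed

section \<open>Shuffle products followed by projection to order chains\<close>

definition nshuffle :: "('a::lattice, 'k::field) chain \<Rightarrow> ('a, 'k) chain \<Rightarrow> ('a, 'k) chain" where
  "nshuffle c d = proj_order (shuffle_product c d)"

lemma proj_order_linear [simp]:
  "proj_order (p + q) = proj_order p + proj_order q"
  "proj_order (p - q) = proj_order p - proj_order q"
  "proj_order (cscale r p) = cscale r (proj_order p)"
  "proj_order 0 = 0"
  by (simp_all add: proj_order_def)

text \<open>A list \<open>z # xs\<close> is strictly decreasing exactly when \<open>xs\<close> is
  and is empty or starts below \<open>z\<close>; the cone tests the second condition.\<close>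

lemma proj_order_concat: "proj_order (concat_chain [z] p) = cone z (proj_order p)"
proof (induction p rule: chain_induct[OF subset_UNIV])
  case (2 xs)
  show ?case by (cases xs) (auto simp: proj_order_def cone_def intro: less_trans)
qed simp_all

lemma nshuffle_linear [simp]:
  "nshuffle (p + q) d = nshuffle p d + nshuffle q d"
  "nshuffle (p - q) d = nshuffle p d - nshuffle q d"
  "nshuffle (- p) d = - nshuffle p d"
  "nshuffle (cscale r p) d = cscale r (nshuffle p d)"
  "nshuffle 0 d = 0"
  "nshuffle c (p + q) = nshuffle c p + nshuffle c q"
  "nshuffle c (p - q) = nshuffle c p - nshuffle c q"
  "nshuffle c (cscale r p) = cscale r (nshuffle c p)"
  "nshuffle c 0 = 0"
  by (simp_all add: nshuffle_def shuffle_product_def proj_order_def lin_ext_fun_add lin_ext_fun_diff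
      lin_ext_fun_cscale lin_ext_fun_zero)

lemma nshuffle_lin_ext: "nshuffle (lin_ext f p) d = lin_ext (\<lambda>x. nshuffle (f x) d) p"
  by (simp add: nshuffle_def shuffle_product_def proj_order_def lin_ext_lin_ext)

lemma nshuffle_lin_ext_right: "nshuffle c (lin_ext f p) = lin_ext (\<lambda>x. nshuffle c (f x)) p"
  by (induction p rule: chain_induct[OF subset_UNIV]) simp_all

lemma nshuffle_single:
  "nshuffle (Poly_Mapping.single xs 1) (Poly_Mapping.single ys 1) = proj_order (shuffle_lists xs ys)"
  by (simp add: nshuffle_def shuffle_product_def)

lemma nshuffle_Nil_single:
  assumes "sorted_wrt (>) xs"
  shows "nshuffle (Poly_Mapping.single [] 1) (Poly_Mapping.single xs 1) = Poly_Mapping.single xs 1"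
    and "nshuffle (Poly_Mapping.single xs 1) (Poly_Mapping.single [] 1) = Poly_Mapping.single xs 1"
  using assms by (simp_all add: nshuffle_single proj_order_def join_tails_sorted)

lemma nshuffle_Nil:
  assumes "p \<in> C_chains A k"
  shows "nshuffle (Poly_Mapping.single [] 1) p = p" and "nshuffle p (Poly_Mapping.single [] 1) = p"
proof -
  have "Poly_Mapping.keys p \<subseteq> order_chains k A" using assms by (simp add: C_chains_def)
  then show "nshuffle (Poly_Mapping.single [] 1) p = p" "nshuffle p (Poly_Mapping.single [] 1) = p"
    by (induction p rule: chain_induct) (simp_all add: nshuffle_Nil_single order_chains_def)
qed

lemma nshuffle_Cons_Cons:
  assumes "sorted_wrt (>) (x # xs)" "sorted_wrt (>) (y # ys)"
  shows "nshuffle (Poly_Mapping.single (x # xs) 1) (Poly_Mapping.single (y # ys) 1) =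
    cone (sup x y) (nshuffle (Poly_Mapping.single xs 1) (Poly_Mapping.single (y # ys) 1)
      + cscale ((- 1) ^ Suc (length xs))
          (nshuffle (Poly_Mapping.single (x # xs) 1) (Poly_Mapping.single ys 1)))"
proof -
  have "Sup_fin (set (x # xs @ y # ys)) = sup x y"
    using assms by (intro Sup_fin_eqI) (auto intro: le_supI1 le_supI2 less_imp_le)
  then show ?thesis
    unfolding nshuffle_single shuffle_lists_Cons_Cons proj_order_concat by simp
qed

text \<open>Bilinear form of the recursion. Here \<open>n\<close> counts the entries of the chains
  in \<open>concat_chain [x] c\<close>; fixing the degree of \<open>c\<close> makes the sign
  uniform.\<close>

lemma nshuffle_concat_concat:
  assumes c: "c \<in> C_chains {u. u < x} (int n - 2)" and d: "d \<in> C_chains {u. u < y} k"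
  shows "nshuffle (concat_chain [x] c) (concat_chain [y] d) =
    cone (sup x y) (nshuffle c (concat_chain [y] d) + cscale ((- 1) ^ n) (nshuffle (concat_chain [x] c) d))"
proof -
  have basis: "nshuffle (Poly_Mapping.single (x # xs) 1) (Poly_Mapping.single (y # ys) 1) =
    cone (sup x y) (nshuffle (Poly_Mapping.single xs 1) (Poly_Mapping.single (y # ys) 1)
      + cscale ((- 1) ^ n) (nshuffle (Poly_Mapping.single (x # xs) 1) (Poly_Mapping.single ys 1)))"
    if "xs \<in> order_chains (int n - 2) {u. u < x}" "ys \<in> order_chains k {u. u < y}" for xs ys
  proof -
    have "n = Suc (length xs)" "sorted_wrt (>) (x # xs)" "sorted_wrt (>) (y # ys)"
      using that by (auto simp: order_chains_def)
    then show ?thesis using nshuffle_Cons_Cons by blast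
  qed
  have right: "nshuffle (Poly_Mapping.single (x # xs) 1) (concat_chain [y] d) =
    cone (sup x y) (nshuffle (Poly_Mapping.single xs 1) (concat_chain [y] d)
      + cscale ((- 1) ^ n) (nshuffle (Poly_Mapping.single (x # xs) 1) d))"
    if "xs \<in> order_chains (int n - 2) {u. u < x}" for xs
  proof -
    have "Poly_Mapping.keys d \<subseteq> order_chains k {u. u < y}" using d by (simp add: C_chains_def)
    then show ?thesis
      by (induction d rule: chain_induct)
        (simp_all add: basis[OF that] chain.scale_right_distrib mult.commute)
  qed
  have "Poly_Mapping.keys c \<subseteq> order_chains (int n - 2) {u. u < x}" using c by (simp add: C_chains_def)
  then show ?thesis
    by (induction c rule: chain_induct)
      (simp_all add: right chain.scale_right_distrib mult.commute)
qed

text \<open>\<open>A\<close> is generalised so that the induction applies to the elements of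
  \<open>A\<close> below \<open>sup x y\<close>, a set closed under joins that the cone with apex
  \<open>sup x y\<close> does not leave.\<close>

lemma nshuffle_single_C_chains:
  assumes "xs \<in> order_chains i A" "ys \<in> order_chains j A" "\<And>u v. u \<in> A \<Longrightarrow> v \<in> A \<Longrightarrow> sup u v \<in> A"
  shows "nshuffle (Poly_Mapping.single xs 1) (Poly_Mapping.single ys (1 :: 'k::field)) \<in> C_chains A (i + j + 1)"
  using assms
proof (induction "length xs + length ys" arbitrary: xs ys A i j rule: less_induct)
  case less
  show ?case
  proof (cases "xs = [] \<or> ys = []")
    case True
    then show ?thesis
      using less.prems by (auto simp: Nil_in_order_chains nshuffle_Nil_single order_chains_def)
  next
    case False
    then obtain x xs' y ys' where eq: "xs = x # xs'" "ys = y # ys'"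
      by (meson neq_Nil_conv)
    let ?z = "sup x y"
    let ?A = "{u \<in> A. u \<le> ?z}"
    have z: "?z \<in> A" and sorted: "sorted_wrt (>) (x # xs')" "sorted_wrt (>) (y # ys')"
      using less.prems by (auto simp: eq order_chains_def)
    have mem: "x # xs' \<in> order_chains i ?A" "xs' \<in> order_chains (i - 1) ?A"
      "y # ys' \<in> order_chains j ?A" "ys' \<in> order_chains (j - 1) ?A"
      using less.prems by (auto simp: eq order_chains_def less_imp_le intro: le_supI1 le_supI2)
    have closed: "sup u v \<in> ?A" if "u \<in> ?A" "v \<in> ?A" for u v
      using that less.prems(3) by auto
    have "nshuffle (Poly_Mapping.single xs' 1) (Poly_Mapping.single (y # ys') (1 :: 'k)) \<in> C_chains ?A (i - 1 + j + 1)"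
      by (rule less.hyps[OF _ mem(2) mem(3) closed]) (simp_all add: eq)
    moreover have "nshuffle (Poly_Mapping.single (x # xs') 1) (Poly_Mapping.single ys' (1 :: 'k)) \<in> C_chains ?A (i + (j - 1) + 1)"
      by (rule less.hyps[OF _ mem(1) mem(4) closed]) (simp_all add: eq)
    ultimately have "nshuffle (Poly_Mapping.single xs 1) (Poly_Mapping.single ys (1 :: 'k)) \<in> C_chains ?A (i + j + 1)"
      unfolding eq nshuffle_Cons_Cons[OF sorted]
      by (intro cone_C_chains[OF _ z] C_chains_closed) simp_all
    then show ?thesis using C_chains_mono[of ?A A] by blast
  qed
qed

lemma nshuffle_C_chains:
  fixes c d :: "('a::lattice, 'k::field) chain"
  assumes "c \<in> C_chains A i" "d \<in> C_chains A j" "\<And>u v. u \<in> A \<Longrightarrow> v \<in> A \<Longrightarrow> sup u v \<in> A"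
  shows "nshuffle c d \<in> C_chains A (i + j + 1)"
proof -
  have *: "nshuffle (Poly_Mapping.single xs 1) d \<in> C_chains A (i + j + 1)"
    if "xs \<in> order_chains i A" for xs
    using nshuffle_lin_ext_right[of "Poly_Mapping.single xs (1 :: 'k)" "\<lambda>x. Poly_Mapping.single x 1" d]
      lin_ext_C_chains[OF assms(2) nshuffle_single_C_chains[OF that _ assms(3)]] by simp
  show ?thesis
    using nshuffle_lin_ext[of "\<lambda>x. Poly_Mapping.single x 1" c d] lin_ext_C_chains[OF assms(1) *] by simp
qed

text \<open>In the recursion \<open>sup x y\<close> is \<open>x\<close>. The term that takes
  \<open>y\<close> first still starts with \<open>x\<close>, so the cone kills it; the term that
  takes \<open>x\<close> first gives the concatenation.\<close>

lemma nshuffle_append: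
  assumes "sorted_wrt (>) (xs @ ys)"
  shows "nshuffle (Poly_Mapping.single xs 1) (Poly_Mapping.single ys 1) = Poly_Mapping.single (xs @ ys) 1"
  using assms
proof (induction "length xs + length ys" arbitrary: xs ys rule: less_induct)
  case less
  show ?case
  proof (cases "xs = [] \<or> ys = []")
    case True
    then show ?thesis using less.prems by (auto simp: nshuffle_Nil_single)
  next
    case False
    then obtain x xs' y ys' where eq: "xs = x # xs'" "ys = y # ys'"
      by (meson neq_Nil_conv)
    have sorted: "sorted_wrt (>) (x # xs')" "sorted_wrt (>) (y # ys')"
      using less.prems by (auto simp: eq sorted_wrt_append)
    have "sup x y = x"
      using less.prems by (auto simp: eq sup_absorb1 less_imp_le)
    moreover have "hd (xs' @ y # ys') < x"
      using less.prems by (cases xs') (auto simp: eq)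
    moreover have "nshuffle (Poly_Mapping.single xs' 1) (Poly_Mapping.single (y # ys') 1)
        = Poly_Mapping.single (xs' @ y # ys') (1 :: 'b)"
      using less.prems by (intro less.hyps) (auto simp: eq)
    moreover have "nshuffle (Poly_Mapping.single (x # xs') 1) (Poly_Mapping.single ys' 1)
        = Poly_Mapping.single (x # xs' @ ys') (1 :: 'b)"
      using less.prems by (subst less.hyps) (auto simp: eq sorted_wrt_append)
    ultimately show ?thesis
      unfolding eq nshuffle_Cons_Cons[OF sorted] by (simp add: cone_def)
  qed
qed

lemma nshuffle_eq_concat:
  assumes "\<chi> \<in> order_chains i A" "p \<in> C_chains {y \<in> B. y < last \<chi>} k" "\<chi> \<noteq> []"
  shows "nshuffle (Poly_Mapping.single \<chi> 1) p = concat_chain \<chi> p"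
proof -
  have sorted: "sorted_wrt (>) (\<chi> @ ys)" if "ys \<in> order_chains k {y \<in> B. y < last \<chi>}" for ys
  proof -
    obtain xs x where \<chi>: "\<chi> = xs @ [x]" using assms(3) by (metis append_butlast_last_id)
    then show ?thesis
      using assms(1) that by (auto simp: order_chains_def sorted_wrt_append intro: less_trans)
  qed
  have "Poly_Mapping.keys p \<subseteq> order_chains k {y \<in> B. y < last \<chi>}"
    using assms(2) by (simp add: C_chains_def)
  then show ?thesis
    by (induction p rule: chain_induct) (simp_all add: nshuffle_append sorted)
qed

text \<open>The recursion writes the product as a cone with apex \<open>sup x y\<close> over
  products of smaller total length. \<open>boundary_cone\<close> applies, the induction hypothesis
  expands the boundary inside the cone, and the recursion turns the remaining cones back into
  products.\<close>

lemma boundary_nshuffle_single: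
  assumes "sorted_wrt (>) xs" "sorted_wrt (>) ys"
  shows "boundary (nshuffle (Poly_Mapping.single xs 1) (Poly_Mapping.single ys (1 :: 'k::field))) =
    nshuffle (boundary (Poly_Mapping.single xs 1)) (Poly_Mapping.single ys 1)
    + cscale ((- 1) ^ length xs)
        (nshuffle (Poly_Mapping.single xs 1) (boundary (Poly_Mapping.single ys 1)))"
  using assms
proof (induction "length xs + length ys" arbitrary: xs ys rule: less_induct)
  case less
  have mem: "xs \<in> order_chains (int (length xs) - 1) UNIV" "ys \<in> order_chains (int (length ys) - 1) UNIV"
    using less.prems by (auto simp: order_chains_def)
  consider "xs = []" | "ys = []" | x xs' y ys' where "xs = x # xs'" "ys = y # ys'"
    by (meson neq_Nil_conv)
  then show ?case
  proof cases
    case 1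
    then show ?thesis
      using less.prems nshuffle_Nil(1)[OF boundary_C_chains[of "Poly_Mapping.single ys (1 :: 'k)"]] mem(2)
      by (simp add: nshuffle_Nil_single)
  next
    case 2
    then show ?thesis
      using less.prems nshuffle_Nil(2)[OF boundary_C_chains[of "Poly_Mapping.single xs (1 :: 'k)"]] mem(1)
      by (simp add: nshuffle_Nil_single)
  next
    case (3 x xs' y ys')
    define X Y X' Y' :: "('a, 'k) chain"
      where XY: "X = Poly_Mapping.single xs' 1" "Y = Poly_Mapping.single ys' 1"
        "X' = Poly_Mapping.single xs 1" "Y' = Poly_Mapping.single ys 1"
    define e :: 'k where "e = (- 1) ^ length xs'"
    let ?z = "sup x y"
    let ?xs = "concat_chain [x] (boundary X)" and ?ys = "concat_chain [y] (boundary Y)"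
    have sorted: "sorted_wrt (>) xs'" "sorted_wrt (>) ys'" "sorted_wrt (>) xs" "sorted_wrt (>) ys"
      using less.prems 3 by auto
    have X'eq: "X' = concat_chain [x] X" and Y'eq: "Y' = concat_chain [y] Y"
      by (simp_all add: XY 3)
    have bdX: "boundary X' = X - ?xs" and bdY: "boundary Y' = Y - ?ys"
      by (simp_all add: X'eq Y'eq boundary_concat_Cons)
    have memX: "X \<in> C_chains {u. u < x} (int (length xs) - 2)"
      and memY: "Y \<in> C_chains {u. u < y} (int (length ys) - 2)"
      using less.prems by (auto simp: XY 3 order_chains_def)
    have memX': "xs \<in> order_chains (int (length xs) - 1) {u. u \<le> ?z}"
        "xs' \<in> order_chains (int (length xs) - 2) {u. u \<le> ?z}"
      and memY': "ys \<in> order_chains (int (length ys) - 1) {u. u \<le> ?z}"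
        "ys' \<in> order_chains (int (length ys) - 2) {u. u \<le> ?z}"
      using less.prems by (auto simp: XY 3 order_chains_def less_imp_le intro: le_supI1 le_supI2)
    have IH1: "boundary (nshuffle X Y') = nshuffle (boundary X) Y' + cscale e (nshuffle X (boundary Y'))"
      unfolding XY e_def using sorted by (intro less.hyps) (simp_all add: 3)
    have IH2: "boundary (nshuffle X' Y) = nshuffle (boundary X') Y - cscale e (nshuffle X' (boundary Y))"
      using less.hyps[of xs ys'] sorted by (simp add: 3 XY e_def)
    have "nshuffle X' Y' = cone ?z (nshuffle X Y' + cscale (- e) (nshuffle X' Y))"
      using nshuffle_Cons_Cons[of x xs' y ys'] sorted by (simp add: 3 XY e_def)
    moreover have "nshuffle X Y' + cscale (- e) (nshuffle X' Y)
        \<in> C_chains {u. u \<le> ?z} (int (length xs) - 2 + (int (length ys) - 1) + 1)"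
    proof (intro C_chains_closed)
      show "nshuffle X Y' \<in> C_chains {u. u \<le> ?z} (int (length xs) - 2 + (int (length ys) - 1) + 1)"
        unfolding XY by (rule nshuffle_single_C_chains[OF memX'(2) memY'(1)]) auto
      have "nshuffle X' Y \<in> C_chains {u. u \<le> ?z} (int (length xs) - 1 + (int (length ys) - 2) + 1)"
        unfolding XY by (rule nshuffle_single_C_chains[OF memX'(1) memY'(2)]) auto
      then show "nshuffle X' Y \<in> C_chains {u. u \<le> ?z} (int (length xs) - 2 + (int (length ys) - 1) + 1)"
        by (simp add: algebra_simps)
    qed
    ultimately have bd: "boundary (nshuffle X' Y') = nshuffle X Y' + cscale (- e) (nshuffle X' Y)
        - cone ?z (boundary (nshuffle X Y' + cscale (- e) (nshuffle X' Y)))"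
      by (simp add: boundary_cone del: cone_linear boundary_linear)
    have r1: "nshuffle ?xs Y' = cone ?z (nshuffle (boundary X) Y' + cscale e (nshuffle ?xs Y))"
      unfolding Y'eq e_def
      by (rule nshuffle_concat_concat[OF _ memY])
        (use boundary_C_chains[OF memX] in \<open>simp add: 3\<close>)
    have r2: "nshuffle X' ?ys = cone ?z (nshuffle X ?ys + cscale (- e) (nshuffle X' (boundary Y)))"
      unfolding X'eq e_def
      using nshuffle_concat_concat[OF memX boundary_C_chains[OF memY]] by (simp add: 3)
    have "e * e = 1" by (simp add: e_def flip: power_add)
    \<comment> \<open>Under the cone the two multiples of \<open>nshuffle X Y\<close> coming from
      \<open>IH1\<close> and \<open>IH2\<close> cancel. What is left is the argument in
      \<open>r1\<close> plus \<open>- e\<close> times the argument in \<open>r2\<close>, by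
      \<open>e * e = 1\<close>.\<close>
    then have "boundary (nshuffle X' Y') = nshuffle (boundary X') Y' + cscale (- e) (nshuffle X' (boundary Y'))"
      by (simp add: bd IH1 IH2 bdX bdY r1 r2 chain.scale_right_distrib chain.scale_right_diff_distrib)
    then show ?thesis by (simp add: XY 3 e_def)
  qed
qed

lemma boundary_nshuffle:
  assumes c: "c \<in> C_chains A (int n - 1)" and d: "d \<in> C_chains B k"
  shows "boundary (nshuffle c d) = nshuffle (boundary c) d + cscale ((- 1) ^ n) (nshuffle c (boundary d))"
proof -
  have right: "boundary (nshuffle (Poly_Mapping.single xs 1) d) =
      nshuffle (boundary (Poly_Mapping.single xs 1)) d
      + cscale ((- 1) ^ n) (nshuffle (Poly_Mapping.single xs 1) (boundary d))"
    if xs: "xs \<in> order_chains (int n - 1) A" for xs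
  proof -
    have [simp]: "length xs = n" "sorted_wrt (>) xs" using xs by (auto simp: order_chains_def)
    have "Poly_Mapping.keys d \<subseteq> order_chains k B" using d by (simp add: C_chains_def)
    then show ?thesis
    proof (induction d rule: chain_induct)
      case (single ys)
      then show ?case using boundary_nshuffle_single[of xs ys] by (simp add: order_chains_def)
    qed (simp_all add: chain.scale_right_distrib mult.commute)
  qed
  have "Poly_Mapping.keys c \<subseteq> order_chains (int n - 1) A" using c by (simp add: C_chains_def)
  then show ?thesis
    by (induction c rule: chain_induct) (simp_all add: right chain.scale_right_distrib mult.commute)
qed

section \<open>The homotopy between the identity and the retraction\<close>

text \<open>The index counts entries, so stage \<open>n\<close> acts in degree \<open>n - 1\<close>.
  The empty chain is fixed by \<open>\<rho>\<close> and gets 0; in each further stage the defect of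
  the homotopy identity is a cycle below the head, and its cone fills it.\<close>

primrec homotopy_op ::
  "(int \<Rightarrow> ('a::order, 'k::field) chain \<Rightarrow> ('a, 'k) chain) \<Rightarrow> nat \<Rightarrow> 'a list \<Rightarrow> ('a, 'k) chain"
where
  "homotopy_op \<rho> 0 xs = 0"
| "homotopy_op \<rho> (Suc n) xs = cone (hd xs) (Poly_Mapping.single xs 1
     - \<rho> (int n) (Poly_Mapping.single xs 1)
     - lin_ext (homotopy_op \<rho> n) (boundary (Poly_Mapping.single xs 1)))"

text \<open>\<open>\<rho> k\<close> is linear only on \<open>C_chains P k\<close>, so the argument
  runs in a subspace of it.\<close>

lemma (in synor_retraction) \<rho>_eq_lin_ext:
  assumes k: "k \<ge> - 2" and a: "a \<in> C_chains P k"
  shows "\<rho> k a = lin_ext (\<lambda>xs. \<rho> k (Poly_Mapping.single xs 1)) a"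
proof -
  let ?V = "{a \<in> C_chains P k. \<rho> k a = lin_ext (\<lambda>xs. \<rho> k (Poly_Mapping.single xs 1)) a}"
  have "\<rho> k 0 = 0"
    using scale[OF k, of 0 0] by (simp add: C_chains_closed)
  then have "chain.subspace ?V"
    using k by (simp add: chain.subspace_def C_chains_closed add scale)
  then have "lin_ext (\<lambda>xs. Poly_Mapping.single xs 1) a \<in> ?V"
    using a by (intro lin_ext_mem) (auto simp: C_chains_def)
  then show ?thesis by simp
qed

text \<open>Support and homotopy identity go together: the support bound allows the cone, and the
  identity one degree lower makes its argument a cycle. For \<open>n = 0\<close> the truncated
  \<open>n - 1\<close> is harmless, as the empty chain has boundary 0.\<close>

lemma (in synor_retraction) homotopy_op:
  assumes "xs \<in> order_chains (int n - 1) P"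
  shows "homotopy_op \<rho> n xs \<in> C_chains {y \<in> P. y \<le> hd xs} (int n) \<and>
    boundary (homotopy_op \<rho> n xs) = Poly_Mapping.single xs 1 - \<rho> (int n - 1) (Poly_Mapping.single xs 1)
      - lin_ext (homotopy_op \<rho> (n - 1)) (boundary (Poly_Mapping.single xs 1))"
  using assms
proof (induction n arbitrary: xs)
  case 0
  then have "xs = []" by (simp add: order_chains_def)
  then show ?case using empty by (simp add: C_chains_closed)
next
  case (Suc n)
  then obtain x xs' where eq: "xs = x # xs'" and x: "x \<in> P"
    by (cases xs) (auto simp: order_chains_def)
  let ?A = "{y \<in> P. y \<le> x}" and ?c = "Poly_Mapping.single xs (1 :: 'k)"
  let ?w = "?c - \<rho> (int n) ?c - lin_ext (homotopy_op \<rho> n) (boundary ?c)"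
  have xs: "xs \<in> order_chains (int n) P" using Suc.prems by simp
  have xsA: "xs \<in> order_chains (int n) ?A"
    using xs by (auto simp: order_chains_def eq less_imp_le)
  have bdA: "boundary ?c \<in> C_chains ?A (int n - 1)" and bdP: "boundary ?c \<in> C_chains P (int n - 1)"
    using boundary_single_C_chains xsA xs by blast+
  have hA: "homotopy_op \<rho> n ys \<in> C_chains ?A (int n)" if ys: "ys \<in> order_chains (int n - 1) ?A" for ys
  proof (cases ys)
    \<comment> \<open>\<open>hd []\<close> is unspecified, so the induction hypothesis gives no
      bound; but the empty list forces \<open>n = 0\<close>, where the value is 0.\<close>
    case Nil
    then have "n = 0" using ys by (simp add: order_chains_def)
    then show ?thesis by (simp add: C_chains_closed)
  next
    case (Cons y zs)
    have "ys \<in> order_chains (int n - 1) P" using ys order_chains_mono[of ?A P] by blast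
    then have "homotopy_op \<rho> n ys \<in> C_chains {u \<in> P. u \<le> y} (int n)"
      using Suc.IH Cons by fastforce
    moreover have "{u \<in> P. u \<le> y} \<subseteq> ?A"
      using ys Cons by (auto simp: order_chains_def intro: order_trans)
    ultimately show ?thesis using C_chains_mono by blast
  qed
  have w: "?w \<in> C_chains ?A (int n)"
    using xsA support[OF _ xs] lin_ext_C_chains[OF bdA hA] by (simp add: C_chains_closed eq)
  \<comment> \<open>Shows that \<open>?w\<close> is a cycle: the homotopy identity is applied to
    each face, the term with two boundaries vanishes, and \<open>\<rho>\<close> commutes with the
    boundary.\<close>
  have "boundary (lin_ext (homotopy_op \<rho> n) (boundary ?c)) =
      lin_ext (\<lambda>ys. Poly_Mapping.single ys 1 - \<rho> (int n - 1) (Poly_Mapping.single ys 1)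
        - lin_ext (homotopy_op \<rho> (n - 1)) (boundary (Poly_Mapping.single ys 1))) (boundary ?c)"
    unfolding boundary_lin_ext
    by (rule lin_ext_cong) (use bdP Suc.IH in \<open>auto simp: C_chains_def\<close>)
  also have "\<dots> = boundary ?c - lin_ext (\<lambda>ys. \<rho> (int n - 1) (Poly_Mapping.single ys 1)) (boundary ?c)
      - lin_ext (homotopy_op \<rho> (n - 1)) (lin_ext (\<lambda>ys. boundary (Poly_Mapping.single ys 1)) (boundary ?c))"
    by (simp add: lin_ext_fun_diff lin_ext_lin_ext)
  also have "lin_ext (\<lambda>ys. boundary (Poly_Mapping.single ys 1)) (boundary ?c) = 0"
    by (simp flip: boundary_lin_ext add: boundary_boundary)
  also have "lin_ext (\<lambda>ys. \<rho> (int n - 1) (Poly_Mapping.single ys 1)) (boundary ?c) = boundary (\<rho> (int n) ?c)"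
    using \<rho>_eq_lin_ext[OF _ bdP] chain_map[of "int n" ?c] xs by simp
  finally have "boundary ?w = 0" by simp
  moreover have "?w \<in> C_chains {y. y \<le> x} (int n)"
    using w C_chains_mono[of ?A "{y. y \<le> x}"] by blast
  ultimately have "boundary (cone x ?w) = ?w"
    using boundary_cone by fastforce
  moreover have "cone x ?w \<in> C_chains ?A (int n + 1)"
    by (rule cone_C_chains[OF w x])
  ultimately show ?case by (simp add: eq add.commute)
qed

section \<open>Slices of synor chains\<close>

text \<open>Recovers the factor \<open>\<zeta> \<chi>\<close> from a representation. Allowing
  \<open>\<chi>\<close> of any length makes it possible to strip one entry at a time.\<close>

definition slice :: "'a list \<Rightarrow> ('a, 'k::field) chain \<Rightarrow> ('a, 'k) chain" where
  "slice \<chi> = lin_ext (\<lambda>xs. if take (length \<chi>) xs = \<chi>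
     then Poly_Mapping.single (drop (length \<chi>) xs) 1 else 0)"

lemma slice_linear [simp]:
  "slice \<chi> (p + q) = slice \<chi> p + slice \<chi> q"
  "slice \<chi> (p - q) = slice \<chi> p - slice \<chi> q"
  "slice \<chi> (cscale r p) = cscale r (slice \<chi> p)"
  "slice \<chi> 0 = 0"
  "slice \<chi> (sum g I) = (\<Sum>i\<in>I. slice \<chi> (g i))"
  by (simp_all add: slice_def)

lemma slice_Nil [simp]: "slice [] p = p"
  by (simp add: slice_def)

lemma slice_concat:
  "length \<chi> = length \<chi>' \<Longrightarrow> slice \<chi> (concat_chain \<chi>' p) = (if \<chi> = \<chi>' then p else 0)"
  by (auto simp: slice_def lin_ext_fun_zero)

lemma slice_Cons_concat: "slice (x # \<chi>) (concat_chain [x] p) = slice \<chi> p"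
  by (simp add: slice_def cong: if_cong)

lemma slice_eq_0:
  assumes "\<And>xs. xs \<in> Poly_Mapping.keys p \<Longrightarrow> take (length \<chi>) xs \<noteq> \<chi>"
  shows "slice \<chi> p = 0"
proof -
  have "slice \<chi> p = lin_ext (\<lambda>_. 0) p"
    unfolding slice_def by (rule lin_ext_cong) (simp add: assms)
  then show ?thesis by (simp add: lin_ext_fun_zero)
qed

lemma slice_below: "p \<in> C_chains {y \<in> A. y < x} k \<Longrightarrow> slice (x # \<chi>) p = 0"
proof (rule slice_eq_0)
  fix xs assume "p \<in> C_chains {y \<in> A. y < x} k" "xs \<in> Poly_Mapping.keys p"
  then have "set xs \<subseteq> {y. y < x}" by (auto simp: C_chains_def order_chains_def)
  then show "take (length (x # \<chi>)) xs \<noteq> x # \<chi>" by (cases xs) auto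
qed

lemma C_top_C_chains: "c \<in> C_top A i x \<Longrightarrow> c \<in> C_chains {y \<in> A. y \<le> x} i"
proof -
  assume c: "c \<in> C_top A i x"
  have "xs \<in> order_chains i {y \<in> A. y \<le> x}" if "xs \<in> Poly_Mapping.keys c" for xs
    using c that by (cases xs) (fastforce simp: C_top_def C_chains_def order_chains_def less_imp_le)+
  then show ?thesis by (auto simp: C_chains_def)
qed

text \<open>The 0-representation: \<open>slice [x] c\<close> is the factor behind the largest
  element.\<close>

lemma C_top_eq_concat_slice:
  assumes "c \<in> C_top A i x"
  shows "concat_chain [x] (slice [x] c) = c" and "slice [x] c \<in> C_chains {y \<in> A. y < x} (i - 1)"
proof -
  have keys: "\<exists>ys. xs = x # ys \<and> ys \<in> order_chains (i - 1) {y \<in> A. y < x}"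
    if "xs \<in> Poly_Mapping.keys c" for xs
    using assms that by (cases xs) (fastforce simp: C_top_def C_chains_def Cons_in_order_chains)+
  have "concat_chain [x] (slice [x] c) = lin_ext (\<lambda>xs. Poly_Mapping.single xs 1) c"
    unfolding slice_def concat_chain_def lin_ext_lin_ext
    by (rule lin_ext_cong) (use keys in fastforce)
  then show "concat_chain [x] (slice [x] c) = c" by simp
  show "slice [x] c \<in> C_chains {y \<in> A. y < x} (i - 1)"
    unfolding slice_def by (rule lin_ext_mem[OF subspace_C_chains]) (use keys in fastforce)
qed

context synor_complex
begin

lemma synor_sub_below_C_chains:
  assumes "i \<ge> 0"
  shows "synor_sub S {y \<in> P. y < x} i \<subseteq> C_chains {y \<in> P. y < x} i"
proof -
  have "S i y \<subseteq> C_chains {y \<in> P. y < x} i" if "y \<in> P" "y < x" for y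
  proof -
    have "{u \<in> P. u \<le> y} \<subseteq> {y \<in> P. y < x}" using that by auto
    then show ?thesis
      using subset_C_top[OF assms that(1)] C_top_C_chains C_chains_mono by blast
  qed
  then have "(\<Union>y\<in>{y \<in> P. y < x}. S i y) \<subseteq> C_chains {y \<in> P. y < x} i" by auto
  from chain.span_minimal[OF this subspace_C_chains] show ?thesis
    using assms by (simp add: synor_sub_def)
qed

text \<open>Write \<open>\<gamma>\<close> as \<open>x\<close> followed by \<open>?s\<close>. Its
  boundary lies strictly below \<open>x\<close>, so the part
  \<open>concat_chain [x] (boundary ?s)\<close> must vanish. Hence \<open>?s\<close> is a cycle
  equal to the boundary of \<open>\<gamma>\<close>, so it is a sum of synor chains one degree lower,
  and induction on \<open>\<chi>\<close> continues with it.\<close>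

lemma boundary_slice:
  assumes "\<gamma> \<in> S i x" "i \<ge> 0" "x \<in> P" "\<chi> \<noteq> []"
  shows "boundary (slice \<chi> \<gamma>) = 0"
  using assms
proof (induction \<chi> arbitrary: i x \<gamma>)
  case (Cons y \<chi>)
  have top: "\<gamma> \<in> C_top P i x" using subset_C_top Cons.prems by blast
  have keys: "xs \<in> order_chains i P" "xs \<noteq> []" "hd xs = x" if "xs \<in> Poly_Mapping.keys \<gamma>" for xs
    using top that by (auto simp: C_top_def C_chains_def)
  \<comment> \<open>Degree 0 is separate because \<open>boundary_S\<close> needs
    \<open>i \<ge> 1\<close>; there only multiples of the empty chain are left after
    slicing.\<close>
  consider "i = 0" | "y \<noteq> x" | "i \<ge> 1" "y = x" using Cons.prems(2) by linarith
  then show ?case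
  proof cases
    case 1
    have "boundary (slice (y # \<chi>) \<gamma>) = lin_ext (\<lambda>_. 0) \<gamma>"
      unfolding slice_def boundary_lin_ext
    proof (rule lin_ext_cong)
      fix xs assume "xs \<in> Poly_Mapping.keys \<gamma>"
      then have "length xs = 1" using keys(1) 1 by (auto simp: order_chains_def)
      then show "boundary (if take (length (y # \<chi>)) xs = y # \<chi>
          then Poly_Mapping.single (drop (length (y # \<chi>)) xs) 1 else 0) = 0"
        by simp
    qed
    then show ?thesis by (simp add: lin_ext_fun_zero)
  next
    case 2
    have "slice (y # \<chi>) \<gamma> = 0"
    proof (rule slice_eq_0)
      fix xs assume "xs \<in> Poly_Mapping.keys \<gamma>"
      then show "take (length (y # \<chi>)) xs \<noteq> y # \<chi>" using keys(2,3)[of xs] 2 by (cases xs) auto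
    qed
    then show ?thesis by simp
  next
    case 3
    let ?s = "slice [x] \<gamma>"
    note s = C_top_eq_concat_slice[OF top]
    have bd: "boundary \<gamma> = ?s - concat_chain [x] (boundary ?s)"
      using boundary_concat_Cons[of x ?s] s(1) by simp
    have bdS: "boundary \<gamma> \<in> synor_sub S {y \<in> P. y < x} (i - 1)"
      using boundary_S 3(1) Cons.prems by blast
    then have "slice [x] (boundary \<gamma>) = 0"
      using synor_sub_below_C_chains[of "i - 1" x] 3(1) slice_below by fastforce
    then have bds: "boundary ?s = 0"
      using slice_below[OF s(2), of "[]"] by (simp add: bd slice_concat)
    show ?thesis
    proof (cases "\<chi> = []")
      case True
      then show ?thesis using bds 3 by simp
    next
      case False
      \<comment> \<open>The claim for \<open>\<chi>\<close> is linear in the chain, so it passes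
        from the summands \<open>S (i - 1) y\<close> to their span, which contains
        \<open>?s\<close>.\<close>
      have "chain.subspace {c. boundary (slice \<chi> c) = 0}"
        by (simp add: chain.subspace_def)
      moreover have "(\<Union>y\<in>{y \<in> P. y < x}. S (i - 1) y) \<subseteq> {c. boundary (slice \<chi> c) = 0}"
        using Cons.IH[OF _ _ _ False] 3(1) by auto
      ultimately have "chain.span (\<Union>y\<in>{y \<in> P. y < x}. S (i - 1) y) \<subseteq> {c. boundary (slice \<chi> c) = 0}"
        by (rule chain.span_minimal[rotated])
      moreover have "?s \<in> chain.span (\<Union>y\<in>{y \<in> P. y < x}. S (i - 1) y)"
        using bdS bd bds 3(1) by (simp add: synor_sub_def)
      ultimately have "boundary (slice \<chi> ?s) = 0" by blast
      then show ?thesis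
        using slice_Cons_concat[of x \<chi> ?s] s(1) 3(2) by simp
    qed
  qed
qed simp

end

section \<open>Comparison of the two cycles relative to \<open>Lcheck\<close>\<close>

lemma sup_closed_Lbar:
  fixes u v w :: "'a::bounded_lattice"
  shows "u \<in> Lbar \<Longrightarrow> v \<in> Lbar \<Longrightarrow> sup u v \<in> Lbar"
    and "u \<in> {y \<in> Lbar. y \<le> w} \<Longrightarrow> v \<in> {y \<in> Lbar. y \<le> w} \<Longrightarrow> sup u v \<in> {y \<in> Lbar. y \<le> w}"
  by (auto simp: Lbar_def sup_eq_bot_iff)

theorem proposition5p3:
  fixes S :: "int \<Rightarrow> 'a::{finite, bounded_lattice} \<Rightarrow> ('a, 'k::field) chain set"
    and \<rho> :: "int \<Rightarrow> ('a, 'k) chain \<Rightarrow> ('a, 'k) chain"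
    and \<gamma> :: "('a, 'k) chain"
    and \<zeta> :: "'a list \<Rightarrow> ('a, 'k) chain"
    and l m :: nat
  assumes "synor_complex Lbar S"
    and "synor_retraction Lbar S \<rho>"
    and "principal_synor_chain Lbar S (int m) top \<gamma>"
    and "1 \<le> l" and "l \<le> m"
    and "is_representation Lbar m l \<gamma> \<zeta>"
  shows "homologous_rel (int m) Lbar Lcheck \<gamma>
    (\<Sum>\<chi>\<in>initial_segments l \<gamma>.
       proj_order (shuffle_product (\<rho> (int l) (Poly_Mapping.single \<chi> 1)) (\<zeta> \<chi>)))"
proof -
  interpret S: synor_complex Lbar S by fact
  interpret R: synor_retraction Lbar S \<rho> by fact
  let ?X = "initial_segments l \<gamma>" and ?s = "\<lambda>\<chi>. Poly_Mapping.single \<chi> (1 :: 'k)"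
  let ?h = "homotopy_op \<rho>"
  let ?z' = "\<Sum>\<chi>\<in>?X. nshuffle (\<rho> (int l) (?s \<chi>)) (\<zeta> \<chi>)"
  have top: "top \<in> (Lbar :: 'a set)" and \<gamma>: "\<gamma> \<in> S (int m) top"
    using assms(3) by (auto simp: principal_synor_chain_def)
  have \<gamma>_top: "\<gamma> \<in> C_top Lbar (int m) top"
    using S.subset_C_top[of "int m" top] top \<gamma> by auto
  have \<chi>: "\<chi> \<in> order_chains (int l) Lbar" "length \<chi> = Suc l" "\<chi> \<noteq> []" if \<chi>X: "\<chi> \<in> ?X" for \<chi>
  proof -
    obtain xs where xs: "xs \<in> Poly_Mapping.keys \<gamma>" "\<chi> = take (Suc l) xs"
      using \<chi>X unfolding initial_segments_def by blast
    then have "xs \<in> order_chains (int m) Lbar" using \<gamma>_top by (auto simp: C_top_def C_chains_def)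
    then show "\<chi> \<in> order_chains (int l) Lbar" "length \<chi> = Suc l" "\<chi> \<noteq> []"
      using xs(2) assms(5) set_take_subset[of "Suc l" xs]
      by (auto simp: order_chains_def sorted_wrt_take)
  qed
  have \<zeta>: "\<zeta> \<chi> \<in> C_chains {y \<in> Lbar. y < last \<chi>} (int m - int l - 1)" if "\<chi> \<in> ?X" for \<chi>
    using assms(6) that by (auto simp: is_representation_def)
  have \<zeta>L: "\<zeta> \<chi> \<in> C_chains Lbar (int m - int l - 1)" if "\<chi> \<in> ?X" for \<chi>
    using \<zeta>[OF that] C_chains_mono[of "{y \<in> Lbar. y < last \<chi>}" Lbar] by blast
  have \<gamma>_rep: "\<gamma> = (\<Sum>\<chi>\<in>?X. concat_chain \<chi> (\<zeta> \<chi>))"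
    using assms(6) by (simp add: is_representation_def)
  have finX: "finite ?X" by (simp add: initial_segments_def)
  \<comment> \<open>All segments in \<open>?X\<close> have \<open>Suc l\<close> entries, so slicing
    at \<open>\<chi>\<close> removes every other summand and returns
    \<open>\<zeta> \<chi>\<close>.\<close>
  have bd\<zeta>: "boundary (\<zeta> \<chi>) = 0" if "\<chi> \<in> ?X" for \<chi>
  proof -
    have "slice \<chi> \<gamma> = (\<Sum>\<chi>'\<in>?X. slice \<chi> (concat_chain \<chi>' (\<zeta> \<chi>')))"
      using arg_cong[OF \<gamma>_rep, of "slice \<chi>"] by simp
    also have "\<dots> = (\<Sum>\<chi>'\<in>?X. if \<chi> = \<chi>' then \<zeta> \<chi>' else 0)"
      by (rule sum.cong[OF refl]) (use \<chi>(2) that in \<open>simp add: slice_concat\<close>)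
    also have "\<dots> = \<zeta> \<chi>" using finX that by simp
    finally show ?thesis
      using S.boundary_slice[OF \<gamma> _ top, of \<chi>] \<chi>(3)[OF that] by simp
  qed
  have h\<chi>: "?h (Suc l) \<chi> \<in> C_chains Lbar (int (Suc l))"
    "boundary (?h (Suc l) \<chi>) = ?s \<chi> - \<rho> (int l) (?s \<chi>) - lin_ext (?h l) (boundary (?s \<chi>))"
    if "\<chi> \<in> ?X" for \<chi>
  proof -
    have "\<chi> \<in> order_chains (int (Suc l) - 1) Lbar" using \<chi>(1)[OF that] by simp
    from R.homotopy_op[OF this] show "?h (Suc l) \<chi> \<in> C_chains Lbar (int (Suc l))"
      "boundary (?h (Suc l) \<chi>) = ?s \<chi> - \<rho> (int l) (?s \<chi>) - lin_ext (?h l) (boundary (?s \<chi>))"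
      using C_chains_mono[of "{y \<in> Lbar. y \<le> hd \<chi>}" Lbar] by (auto simp del: homotopy_op.simps)
  qed
  define w where "w = (\<Sum>\<chi>\<in>?X. nshuffle (?h (Suc l) \<chi>) (\<zeta> \<chi>))"
  \<comment> \<open>Faces of \<open>\<chi>\<close> have \<open>l\<close> entries, hence the cut
    after \<open>l\<close>. A single face may still contain the top element; such terms cancel only
    in the boundary of \<open>\<gamma>\<close>, so the error term is written as a function of that
    boundary.\<close>
  define \<Phi> where "\<Phi> = lin_ext (\<lambda>b. nshuffle (?h l (take l b)) (?s (drop l b)))"
  have \<Phi>_concat: "\<Phi> (concat_chain a p) = nshuffle (?h l a) p" if "length a = l" for a p
    using nshuffle_lin_ext_right[of "?h l a" "\<lambda>x. Poly_Mapping.single x 1" p] that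
    by (simp add: \<Phi>_def)
  have "boundary \<gamma> = (\<Sum>\<chi>\<in>?X. lin_ext (\<lambda>a. concat_chain a (\<zeta> \<chi>)) (boundary (?s \<chi>)))"
    using arg_cong[OF \<gamma>_rep, of boundary] by (simp add: boundary_concat bd\<zeta> cong: sum.cong)
  then have "\<Phi> (boundary \<gamma>) = (\<Sum>\<chi>\<in>?X. lin_ext (\<lambda>a. \<Phi> (concat_chain a (\<zeta> \<chi>))) (boundary (?s \<chi>)))"
    by (simp add: \<Phi>_def lin_ext_lin_ext)
  also have "\<dots> = (\<Sum>\<chi>\<in>?X. lin_ext (\<lambda>a. nshuffle (?h l a) (\<zeta> \<chi>)) (boundary (?s \<chi>)))"
  proof (intro sum.cong[OF refl] lin_ext_cong \<Phi>_concat)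
    fix \<chi> a assume "\<chi> \<in> ?X" and a: "a \<in> Poly_Mapping.keys (boundary (?s \<chi>))"
    then have "boundary (?s \<chi>) \<in> C_chains Lbar (int l - 1)"
      using \<chi>(1) boundary_single_C_chains by blast
    then show "length a = l" using a by (auto simp: C_chains_def order_chains_def)
  qed
  also have "\<dots> = (\<Sum>\<chi>\<in>?X. nshuffle (lin_ext (?h l) (boundary (?s \<chi>))) (\<zeta> \<chi>))"
    by (simp add: nshuffle_lin_ext)
  finally have \<Phi>_bd: "\<Phi> (boundary \<gamma>) = (\<Sum>\<chi>\<in>?X. nshuffle (lin_ext (?h l) (boundary (?s \<chi>))) (\<zeta> \<chi>))" .
  have "boundary w = (\<Sum>\<chi>\<in>?X. nshuffle (boundary (?h (Suc l) \<chi>)) (\<zeta> \<chi>))"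
    unfolding w_def boundary_linear
  proof (rule sum.cong[OF refl])
    fix \<chi> assume \<chi>X: "\<chi> \<in> ?X"
    \<comment> \<open>\<open>boundary_nshuffle\<close> counts entries, and chains of degree
      \<open>Suc l\<close> have \<open>l + 2\<close> of them.\<close>
    have "?h (Suc l) \<chi> \<in> C_chains Lbar (int (l + 2) - 1)" using h\<chi>(1)[OF \<chi>X] by simp
    from boundary_nshuffle[OF this \<zeta>L[OF \<chi>X]]
    show "boundary (nshuffle (?h (Suc l) \<chi>) (\<zeta> \<chi>)) = nshuffle (boundary (?h (Suc l) \<chi>)) (\<zeta> \<chi>)"
      by (simp add: bd\<zeta>[OF \<chi>X] del: homotopy_op.simps)
  qed
  \<comment> \<open>The identity term of the homotopy identity shuffles to a concatenation because
    \<open>\<zeta> \<chi>\<close> lies below \<open>last \<chi>\<close>; these terms add up to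
    \<open>\<gamma>\<close>.\<close>
  also have "\<dots> = (\<Sum>\<chi>\<in>?X. concat_chain \<chi> (\<zeta> \<chi>) - nshuffle (\<rho> (int l) (?s \<chi>)) (\<zeta> \<chi>)
      - nshuffle (lin_ext (?h l) (boundary (?s \<chi>))) (\<zeta> \<chi>))"
    by (rule sum.cong[OF refl])
      (simp add: h\<chi>(2) nshuffle_eq_concat[OF \<chi>(1) \<zeta> \<chi>(3)] del: homotopy_op.simps)
  also have "\<dots> = \<gamma> - ?z' - \<Phi> (boundary \<gamma>)"
    by (simp only: sum_subtractf \<Phi>_bd flip: \<gamma>_rep)
  finally have diff: "\<gamma> - ?z' = boundary w + \<Phi> (boundary \<gamma>)" by (simp add: algebra_simps)
  have w: "w \<in> C_chains Lbar (int m + 1)"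
    unfolding w_def
  proof (rule C_chains_closed)
    fix \<chi> assume "\<chi> \<in> ?X"
    then have "nshuffle (?h (Suc l) \<chi>) (\<zeta> \<chi>) \<in> C_chains Lbar (int (Suc l) + (int m - int l - 1) + 1)"
      by (intro nshuffle_C_chains h\<chi>(1) \<zeta>L sup_closed_Lbar(1))
    then show "nshuffle (?h (Suc l) \<chi>) (\<zeta> \<chi>) \<in> C_chains Lbar (int m + 1)"
      by (simp add: add.commute del: homotopy_op.simps)
  qed
  have "{y \<in> Lbar. y < (top :: 'a)} = Lcheck" by (auto simp: Lbar_def Lcheck_def less_top)
  then have bd\<gamma>: "boundary \<gamma> \<in> C_chains Lcheck (int m - 1)"
    using S.boundary_S[of "int m" top] S.synor_sub_below_C_chains[of "int m - 1" top] \<gamma> top assms(4,5)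
    by auto
  have LcheckLbar: "(Lcheck :: 'a set) \<subseteq> Lbar" by (auto simp: Lbar_def Lcheck_def)
  have \<Phi>: "\<Phi> (boundary \<gamma>) \<in> C_chains Lcheck (int m)"
    unfolding \<Phi>_def
  proof (rule lin_ext_C_chains[OF bd\<gamma>])
    fix b :: "'a list" assume b: "b \<in> order_chains (int m - 1) Lcheck"
    then obtain x b' where eq: "b = x # b'" using assms(4,5) by (cases b) (auto simp: order_chains_def)
    \<comment> \<open>Both factors of the shuffle stay below the head \<open>x\<close> of
      \<open>b\<close>. As \<open>x\<close> is not the top element, \<open>?A\<close> is a
      join-closed part of \<open>Lcheck\<close>.\<close>
    let ?A = "{y \<in> Lbar. y \<le> x}"
    have sub: "?A \<subseteq> Lcheck"
      using b eq by (auto simp: order_chains_def Lbar_def Lcheck_def top_unique)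
    have bA: "b \<in> order_chains (int m - 1) ?A"
      using b LcheckLbar by (auto simp: order_chains_def eq less_imp_le)
    have t: "take l b \<in> order_chains (int l - 1) ?A" and d: "drop l b \<in> order_chains (int m - 1 - int l) ?A"
      using bA assms(5) set_take_subset[of l b] set_drop_subset[of l b]
      by (auto simp: order_chains_def sorted_wrt_take sorted_wrt_drop)
    have "take l b \<in> order_chains (int l - 1) Lbar"
      using t order_chains_mono[of ?A Lbar] by blast
    then have "?h l (take l b) \<in> C_chains {y \<in> Lbar. y \<le> hd (take l b)} (int l)"
      using R.homotopy_op by blast
    \<comment> \<open>As \<open>l \<ge> 1\<close>, the first piece is nonempty and keeps the head of
      \<open>b\<close>.\<close>
    moreover have "hd (take l b) = x" using eq assms(4) by (cases l) auto
    ultimately have "nshuffle (?h l (take l b)) (?s (drop l b)) \<in> C_chains ?A (int l + (int m - 1 - int l) + 1)"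
      using d by (intro nshuffle_C_chains sup_closed_Lbar(2)) simp_all
    then show "nshuffle (?h l (take l b)) (?s (drop l b)) \<in> C_chains Lcheck (int m)"
      using C_chains_mono[OF sub] by auto
  qed
  have \<gamma>C: "\<gamma> \<in> C_chains Lbar (int m)" using \<gamma>_top by (simp add: C_top_def)
  \<comment> \<open>That \<open>?z'\<close> is a relative cycle is read off from this expression:
    its boundary differs from that of \<open>\<gamma>\<close> by the boundary of a chain in
    \<open>Lcheck\<close>.\<close>
  have z': "?z' = \<gamma> - (boundary w + \<Phi> (boundary \<gamma>))" using diff by (simp add: algebra_simps)
  have "boundary w + \<Phi> (boundary \<gamma>) \<in> C_chains Lbar (int m)"
    using boundary_C_chains[OF w] \<Phi> C_chains_mono[OF LcheckLbar] by (intro C_chains_closed) auto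
  then have "?z' \<in> C_chains Lbar (int m)" unfolding z' by (rule chain.subspace_diff[OF subspace_C_chains \<gamma>C])
  moreover have "boundary ?z' \<in> C_chains Lcheck (int m - 1)"
    unfolding z' using bd\<gamma> boundary_C_chains[OF \<Phi>]
    by (simp add: boundary_boundary C_chains_closed)
  ultimately have "?z' \<in> rel_cycles (int m) Lbar Lcheck" by (simp add: rel_cycles_def)
  moreover have "\<gamma> \<in> rel_cycles (int m) Lbar Lcheck" using \<gamma>C bd\<gamma> by (simp add: rel_cycles_def)
  moreover have "\<gamma> - ?z' \<in> rel_boundaries (int m) Lbar Lcheck"
    using w \<Phi> diff by (auto simp: rel_boundaries_def)
  ultimately show ?thesis by (simp add: homologous_rel_def nshuffle_def)
qed

end
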